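(* Let $(G,g)$ be a connected Lie group endowed with a left invariant Riemannian metric such that for every $a\in G$ the inner automorphism $i_a:(G,g)\to(G,g)$, $x\mapsto axa^{-1}$, is harmonic. Then $g$ is bi-invariant.
   Context: A Riemannian metric on a Lie group is bi-invariant if it is both left and right invariant. A smooth map $\phi$ of Riemannian manifolds is harmonic if its tension field $\tau(\phi)=\mathrm{tr}\,\nabla d\phi$ vanishes. *)

theory Defs
  imports "HOL-Analysis.Analysis" "HOL-Algebra.Group"
begin

section \<open>Smooth maps between open subsets of finite-dimensional spaces\<close>

text \<open>
  Class \<open>C\<^sup>k\<close> on an open set \<open>S\<close>, by iterated directional derivatives. This is the usual
  notion only when the source space is finite-dimensional, which
  \<open>smooth_manifold\<close> below demands of the model space.
\<close>

primrec C_k_on :: "nat \<Rightarrow> 'a::real_normed_vector set \<Rightarrow> ('a \<Rightarrow> 'b::real_normed_vector) \<Rightarrow> bool" where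
  "C_k_on 0 S f \<longleftrightarrow> continuous_on S f"
| "C_k_on (Suc k) S f \<longleftrightarrow>
     (\<forall>x\<in>S. f differentiable (at x)) \<and> (\<forall>v. C_k_on k S (\<lambda>x. frechet_derivative f (at x) v))"

definition smooth_on :: "'a::real_normed_vector set \<Rightarrow> ('a \<Rightarrow> 'b::real_normed_vector) \<Rightarrow> bool" where
  "smooth_on S f \<longleftrightarrow> (\<forall>k. C_k_on k S f)"


section \<open>Smooth manifolds\<close>

text \<open>
  A chart is a pair of a domain and a map; values of the map outside the domain are irrelevant.
  The model space is a normed space with a finite spanning set instead of a type of class
  \<open>euclidean_space\<close>, because the latter excludes dimension \<open>0\<close>.
\<close>

type_synonym ('p, 'e) chart = "'p set \<times> ('p \<Rightarrow> 'e)"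

definition chart_inv :: "('p, 'e) chart \<Rightarrow> 'e \<Rightarrow> 'p" where
  "chart_inv c = inv_into (fst c) (snd c)"

definition charts_at :: "('p, 'e) chart set \<Rightarrow> 'p \<Rightarrow> ('p, 'e) chart set" where
  "charts_at A p = {c \<in> A. p \<in> fst c}"

definition local_rep :: "('p, 'e) chart \<Rightarrow> ('q, 'f) chart \<Rightarrow> ('p \<Rightarrow> 'q) \<Rightarrow> 'e \<Rightarrow> 'f" where
  "local_rep c d \<phi> = snd d \<circ> \<phi> \<circ> chart_inv c"

definition smooth_manifold :: "'p topology \<Rightarrow> ('p, 'e::real_normed_vector) chart set \<Rightarrow> bool" where
  "smooth_manifold T A \<longleftrightarrow>
     (\<exists>B::'e set. finite B \<and> span B = UNIV) \<and>
     Hausdorff_space T \<and> second_countable T \<and>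
     (\<Union>c\<in>A. fst c) = topspace T \<and>
     (\<forall>c\<in>A. openin T (fst c) \<and> open (snd c ` fst c) \<and>
        homeomorphic_map (subtopology T (fst c)) (top_of_set (snd c ` fst c)) (snd c)) \<and>
     (\<forall>c\<in>A. \<forall>d\<in>A. smooth_on (snd c ` (fst c \<inter> fst d)) (local_rep c d (\<lambda>p. p)))"

definition smooth_map ::
  "'p topology \<Rightarrow> ('p, 'e::real_normed_vector) chart set \<Rightarrow>
   'q topology \<Rightarrow> ('q, 'f::real_normed_vector) chart set \<Rightarrow> ('p \<Rightarrow> 'q) \<Rightarrow> bool" where
  "smooth_map T A T' A' \<phi> \<longleftrightarrow>
     continuous_map T T' \<phi> \<and>
     (\<forall>c\<in>A. \<forall>d\<in>A'. smooth_on (snd c ` (fst c \<inter> \<phi> -` fst d)) (local_rep c d \<phi>))"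

definition prod_atlas :: "('p, 'e) chart set \<Rightarrow> ('q, 'f) chart set \<Rightarrow> ('p \<times> 'q, 'e \<times> 'f) chart set" where
  "prod_atlas A A' = {(fst c \<times> fst d, map_prod (snd c) (snd d)) | c d. c \<in> A \<and> d \<in> A'}"


section \<open>Tangent vectors and differentials\<close>

text \<open>
  A tangent vector at \<open>p\<close> is the family of its components in all charts around \<open>p\<close>, related by
  the derivatives of the transition maps (and \<open>0\<close> at all other pairs, so that equality of tangent
  vectors is equality of families).
\<close>

type_synonym ('p, 'e) tvec = "('p, 'e) chart \<Rightarrow> 'e"

definition tangent_space ::
  "('p, 'e::real_normed_vector) chart set \<Rightarrow> 'p \<Rightarrow> ('p, 'e) tvec set" where
  "tangent_space A p =
     {v. (\<forall>c\<in>charts_at A p. \<forall>d\<in>charts_at A p.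
            v d = frechet_derivative (local_rep c d (\<lambda>q. q)) (at (snd c p)) (v c)) \<and>
         (\<forall>c. c \<notin> charts_at A p \<longrightarrow> v c = 0)}"

text \<open>The tangent vector at \<open>p\<close> whose component in the chart \<open>c\<close> is \<open>u\<close>.\<close>

definition coord_tvec ::
  "('p, 'e::real_normed_vector) chart set \<Rightarrow> ('p, 'e) chart \<Rightarrow> 'p \<Rightarrow> 'e \<Rightarrow> ('p, 'e) tvec" where
  "coord_tvec A c p u =
     (\<lambda>d. if d \<in> charts_at A p
          then frechet_derivative (local_rep c d (\<lambda>q. q)) (at (snd c p)) u else 0)"

text \<open>By the chain rule, the choice of \<open>c\<close> does not matter for tangent vectors \<open>v\<close> at \<open>p\<close>.\<close>

definition differential ::
  "('p, 'e::real_normed_vector) chart set \<Rightarrow> ('q, 'f::real_normed_vector) chart set \<Rightarrow>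
   ('p \<Rightarrow> 'q) \<Rightarrow> 'p \<Rightarrow> ('p, 'e) tvec \<Rightarrow> ('q, 'f) tvec" where
  "differential A A' \<phi> p v =
     (let c = (SOME c. c \<in> charts_at A p) in
      (\<lambda>d. if d \<in> charts_at A' (\<phi> p)
           then frechet_derivative (local_rep c d \<phi>) (at (snd c p)) (v c) else 0))"


section \<open>Riemannian metrics and the Levi-Civita connection\<close>

type_synonym ('p, 'e) metric = "'p \<Rightarrow> ('p, 'e) tvec \<Rightarrow> ('p, 'e) tvec \<Rightarrow> real"

definition metric_in_chart ::
  "('p, 'e::real_normed_vector) chart set \<Rightarrow> ('p, 'e) metric \<Rightarrow> ('p, 'e) chart \<Rightarrow>
   'e \<Rightarrow> 'e \<Rightarrow> 'e \<Rightarrow> real" where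
  "metric_in_chart A g c x u v =
     (let p = chart_inv c x in g p (coord_tvec A c p u) (coord_tvec A c p v))"

definition riemannian_metric ::
  "'p topology \<Rightarrow> ('p, 'e::real_normed_vector) chart set \<Rightarrow> ('p, 'e) metric \<Rightarrow> bool" where
  "riemannian_metric T A g \<longleftrightarrow>
     (\<forall>p\<in>topspace T. \<forall>u\<in>tangent_space A p. \<forall>v\<in>tangent_space A p.
        g p u v = g p v u \<and>
        (\<forall>w\<in>tangent_space A p. \<forall>r s.
           g p (\<lambda>c. r *\<^sub>R u c + s *\<^sub>R v c) w = r * g p u w + s * g p v w) \<and>
        (u \<noteq> (\<lambda>c. 0) \<longrightarrow> 0 < g p u u)) \<and>
     (\<forall>c\<in>A. \<forall>u v. smooth_on (snd c ` fst c) (\<lambda>x. metric_in_chart A g c x u v))"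

text \<open>
  The Levi-Civita connection in the chart \<open>c\<close> is \<open>\<nabla>\<^sub>u v = D v(u) + \<Gamma> u v\<close>, where the bilinear
  map \<open>\<Gamma>\<close> (the Christoffel symbols) at the point with coordinates \<open>x\<close> is the unique one which is
  torsion-free (symmetric) and compatible with the metric.
\<close>

definition christoffel ::
  "('p, 'e::real_normed_vector) chart set \<Rightarrow> ('p, 'e) metric \<Rightarrow> ('p, 'e) chart \<Rightarrow>
   'e \<Rightarrow> 'e \<Rightarrow> 'e \<Rightarrow> 'e" where
  "christoffel A g c x =
     (THE \<Gamma>. bilinear \<Gamma> \<and> (\<forall>u v. \<Gamma> u v = \<Gamma> v u) \<and>
        (\<forall>w u v. frechet_derivative (\<lambda>y. metric_in_chart A g c y u v) (at x) w =
                   metric_in_chart A g c x (\<Gamma> w u) v + metric_in_chart A g c x u (\<Gamma> w v)))"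


section \<open>Harmonic maps\<close>

text \<open>
  \<open>\<nabla>d\<phi>\<close> in charts \<open>c\<close>, \<open>d\<close> of source and target, for the connection on
  \<open>T\<^sup>*M \<otimes> \<phi>\<^sup>*TN\<close> induced by the Levi-Civita connections:
  \<open>(\<nabla>d\<phi>)(u, v) = \<nabla>\<^sub>u (d\<phi> v) - d\<phi> (\<nabla>\<^sub>u v)\<close> for \<open>v\<close> with constant components.
\<close>

definition second_fundamental_form ::
  "('p, 'e::real_normed_vector) chart set \<Rightarrow> ('p, 'e) metric \<Rightarrow>
   ('q, 'f::real_normed_vector) chart set \<Rightarrow> ('q, 'f) metric \<Rightarrow> ('p \<Rightarrow> 'q) \<Rightarrow>
   ('p, 'e) chart \<Rightarrow> ('q, 'f) chart \<Rightarrow> 'e \<Rightarrow> 'e \<Rightarrow> 'e \<Rightarrow> 'f" where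
  "second_fundamental_form A g A' h \<phi> c d x u v =
     (let f = local_rep c d \<phi>; D = (\<lambda>y. frechet_derivative f (at y)) in
      frechet_derivative (\<lambda>y. D y v) (at x) u
      + christoffel A' h d (f x) (D x u) (D x v)
      - D x (christoffel A g c x u v))"

definition orthonormal_basis :: "('e::real_vector \<Rightarrow> 'e \<Rightarrow> real) \<Rightarrow> 'e set \<Rightarrow> bool" where
  "orthonormal_basis \<beta> B \<longleftrightarrow>
     finite B \<and> span B = UNIV \<and> (\<forall>u\<in>B. \<forall>v\<in>B. \<beta> u v = (if u = v then 1 else 0))"

text \<open>The choice of the orthonormal basis does not affect the trace of a bilinear map.\<close>

definition metric_trace ::
  "('e::real_vector \<Rightarrow> 'e \<Rightarrow> real) \<Rightarrow> ('e \<Rightarrow> 'e \<Rightarrow> 'f::real_vector) \<Rightarrow> 'f" where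
  "metric_trace \<beta> b = (\<Sum>e\<in>(SOME B. orthonormal_basis \<beta> B). b e e)"

text \<open>The component in the chart \<open>d\<close> of the tension field at the point with \<open>c\<close>-coordinates \<open>x\<close>.\<close>

definition tension ::
  "('p, 'e::real_normed_vector) chart set \<Rightarrow> ('p, 'e) metric \<Rightarrow>
   ('q, 'f::real_normed_vector) chart set \<Rightarrow> ('q, 'f) metric \<Rightarrow> ('p \<Rightarrow> 'q) \<Rightarrow>
   ('p, 'e) chart \<Rightarrow> ('q, 'f) chart \<Rightarrow> 'e \<Rightarrow> 'f" where
  "tension A g A' h \<phi> c d x =
     metric_trace (metric_in_chart A g c x) (second_fundamental_form A g A' h \<phi> c d x)"

definition harmonic_map ::
  "'p topology \<Rightarrow> ('p, 'e::real_normed_vector) chart set \<Rightarrow> ('p, 'e) metric \<Rightarrow>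
   'q topology \<Rightarrow> ('q, 'f::real_normed_vector) chart set \<Rightarrow> ('q, 'f) metric \<Rightarrow>
   ('p \<Rightarrow> 'q) \<Rightarrow> bool" where
  "harmonic_map T A g T' A' h \<phi> \<longleftrightarrow>
     smooth_map T A T' A' \<phi> \<and>
     (\<forall>p\<in>topspace T. \<forall>c\<in>charts_at A p. \<forall>d\<in>charts_at A' (\<phi> p).
        tension A g A' h \<phi> c d (snd c p) = 0)"


section \<open>Lie groups and invariant metrics\<close>

definition lie_group ::
  "('p, 'm) monoid_scheme \<Rightarrow> 'p topology \<Rightarrow> ('p, 'e::real_normed_vector) chart set \<Rightarrow> bool" where
  "lie_group G T A \<longleftrightarrow>
     group G \<and> smooth_manifold T A \<and> topspace T = carrier G \<and>
     smooth_map (prod_topology T T) (prod_atlas A A) T A (\<lambda>(x, y). x \<otimes>\<^bsub>G\<^esub> y) \<and>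
     smooth_map T A T A (\<lambda>x. inv\<^bsub>G\<^esub> x)"

definition isometric_map ::
  "'p topology \<Rightarrow> ('p, 'e::real_normed_vector) chart set \<Rightarrow> ('p, 'e) metric \<Rightarrow> ('p \<Rightarrow> 'p) \<Rightarrow> bool" where
  "isometric_map T A g \<phi> \<longleftrightarrow>
     (\<forall>p\<in>topspace T. \<forall>u\<in>tangent_space A p. \<forall>v\<in>tangent_space A p.
        g (\<phi> p) (differential A A \<phi> p u) (differential A A \<phi> p v) = g p u v)"

definition left_invariant_metric ::
  "('p, 'm) monoid_scheme \<Rightarrow> 'p topology \<Rightarrow> ('p, 'e::real_normed_vector) chart set \<Rightarrow>
   ('p, 'e) metric \<Rightarrow> bool" where
  "left_invariant_metric G T A g \<longleftrightarrow> (\<forall>a\<in>carrier G. isometric_map T A g (\<lambda>x. a \<otimes>\<^bsub>G\<^esub> x))"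

definition right_invariant_metric ::
  "('p, 'm) monoid_scheme \<Rightarrow> 'p topology \<Rightarrow> ('p, 'e::real_normed_vector) chart set \<Rightarrow>
   ('p, 'e) metric \<Rightarrow> bool" where
  "right_invariant_metric G T A g \<longleftrightarrow> (\<forall>a\<in>carrier G. isometric_map T A g (\<lambda>x. x \<otimes>\<^bsub>G\<^esub> a))"

definition bi_invariant_metric ::
  "('p, 'm) monoid_scheme \<Rightarrow> 'p topology \<Rightarrow> ('p, 'e::real_normed_vector) chart set \<Rightarrow>
   ('p, 'e) metric \<Rightarrow> bool" where
  "bi_invariant_metric G T A g \<longleftrightarrow>
     left_invariant_metric G T A g \<and> right_invariant_metric G T A g"

definition inner_automorphism :: "('p, 'm) monoid_scheme \<Rightarrow> 'p \<Rightarrow> 'p \<Rightarrow> 'p" where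
  "inner_automorphism G a = (\<lambda>x. a \<otimes>\<^bsub>G\<^esub> x \<otimes>\<^bsub>G\<^esub> inv\<^bsub>G\<^esub> a)"

end

theory Submission
  imports Defs
begin

text \<open>
  Let \<open>U = \<Sum>\<^sub>i \<nabla>\<^bsub>e\<^sub>i\<^esub> e\<^sub>i\<close> for an orthonormal basis \<open>e\<^sub>i\<close> of the Lie algebra and \<open>F = Ad a\<close>. At the identity,
  the tension field of \<open>i\<^sub>a\<close> is \<open>\<Sum>\<^sub>i \<nabla>\<^bsub>F e\<^sub>i\<^esub> (F e\<^sub>i) - F U\<close>, where \<open>\<nabla>\<close> is the Levi-Civita connection on
  left-invariant fields. Differentiating its vanishing in \<open>a\<close> at the identity in direction \<open>X\<close> and
  pairing with \<open>X\<close> gives \<open>1/2 \<bar>ad X + (ad X)\<^sup>T\<bar>\<^sup>2 = - \<langle>U, \<nabla>\<^sub>X X\<rangle>\<close>. Summing over \<open>X = e\<^sub>j\<close> yields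
  \<open>- \<bar>U\<bar>\<^sup>2\<close> on the right, so every \<open>ad X\<close> is skew. As \<open>G\<close> is connected, every \<open>Ad a\<close> is then an
  isometry, which together with left invariance is right invariance.

  All of this is carried out in one chart around the identity. There the multiplication
  \<open>m(x, y) = x + y + b(x, y) + \<dots>\<close> has the mixed second derivative \<open>b\<close> (called \<open>mult2\<close>); the bracket is
  \<open>b(u, v) - b(v, u)\<close>, the second derivative of \<open>i\<^sub>a\<close> is \<open>b(F u, F v) - F b(u, v)\<close>, and \<open>\<nabla> = \<Gamma> + b\<close> with
  the Christoffel symbols \<open>\<Gamma>\<close>.
\<close>

section \<open>Finite-dimensional normed spaces\<close>

text \<open>A complete subspace is closed, so \<open>t\<close> has positive distance from
  \<open>W\<close>; rescaling by \<open>r\<close> turns this distance into a bound on the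
  coefficient of \<open>t\<close>.\<close>

lemma complete_subspace_separation:
  fixes W :: "'a::real_normed_vector set"
  assumes "complete W" "subspace W" "t \<notin> W"
  obtains \<delta> where "\<delta> > 0" "\<And>w r. w \<in> W \<Longrightarrow> \<delta> * \<bar>r\<bar> \<le> norm (w + r *\<^sub>R t)"
proof -
  have "closed W" using assms complete_imp_closed by blast
  then have "open (- W)" "t \<in> - W" using assms by auto
  then obtain \<delta> where d: "\<delta> > 0" "ball t \<delta> \<subseteq> - W" using openE by blast
  have "\<delta> * \<bar>r\<bar> \<le> norm (w + r *\<^sub>R t)" if "w \<in> W" for w r
  proof (cases "r = 0")
    case False
    have "(- inverse r) *\<^sub>R w \<in> W" using that assms(2) subspace_scale by blast
    then have "(- inverse r) *\<^sub>R w \<notin> ball t \<delta>" using d by blast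
    then have "\<delta> \<le> norm (t + inverse r *\<^sub>R w)" by (simp add: dist_norm)
    also have "t + inverse r *\<^sub>R w = inverse r *\<^sub>R (w + r *\<^sub>R t)" using False by (simp add: scaleR_add_right)
    finally have "\<delta> \<le> norm (w + r *\<^sub>R t) / \<bar>r\<bar>" by (simp add: divide_inverse mult.commute)
    then show ?thesis using False by (simp add: pos_le_divide_eq)
  qed auto
  with d(1) show thesis by (rule that)
qed

text \<open>By the separation bound the coefficients of \<open>t\<close> along a Cauchy sequence are
  Cauchy themselves, so the coefficients and the parts in \<open>W\<close> converge
  separately.\<close>

lemma complete_span_insert:
  fixes W :: "'a::real_normed_vector set"
  assumes W: "complete W" "subspace W"
  shows "complete (span (insert t W))"
proof (cases "t \<in> W")
  case True
  then show ?thesis using W by (simp add: insert_absorb span_eq_iff[THEN iffD2])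
next
  case False
  obtain \<delta> where d: "\<delta> > 0" "\<And>w r. w \<in> W \<Longrightarrow> \<delta> * \<bar>r\<bar> \<le> norm (w + r *\<^sub>R t)"
    using complete_subspace_separation[OF W False] by blast
  have sp: "span (insert t W) = {x. \<exists>k. x - k *\<^sub>R t \<in> W}"
    using span_insert[of t W] W(2) by (simp add: span_eq_iff[THEN iffD2])
  show ?thesis unfolding complete_def
  proof (intro allI impI, elim conjE)
    fix f assume fin: "\<forall>n. f n \<in> span (insert t W)" and C: "Cauchy f"
    have "\<forall>n. \<exists>k. f n - k *\<^sub>R t \<in> W" using fin sp by auto
    then obtain r where r: "\<And>n. f n - r n *\<^sub>R t \<in> W" by metis
    have le: "\<delta> * \<bar>r m - r n\<bar> \<le> norm (f m - f n)" for m n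
    proof -
      have "(f m - r m *\<^sub>R t) - (f n - r n *\<^sub>R t) \<in> W" using r W(2) subspace_diff by blast
      from d(2)[OF this, of "r m - r n"] show ?thesis by (simp add: algebra_simps)
    qed
    have "Cauchy r"
    proof (rule metric_CauchyI)
      fix e :: real assume "e > 0"
      then have "\<delta> * e > 0" using d by simp
      then obtain M where M: "\<forall>m\<ge>M. \<forall>n\<ge>M. dist (f m) (f n) < \<delta> * e" using C metric_CauchyD by blast
      have "dist (r m) (r n) < e" if "m \<ge> M" "n \<ge> M" for m n
      proof -
        have "\<delta> * \<bar>r m - r n\<bar> < \<delta> * e" using le[of m n] M that by (force simp: dist_norm)
        then show ?thesis using d by (simp add: dist_real_def)
      qed
      then show "\<exists>M. \<forall>m\<ge>M. \<forall>n\<ge>M. dist (r m) (r n) < e" by blast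
    qed
    then obtain s where s: "r \<longlonglongrightarrow> s" using Cauchy_convergent convergent_def by blast
    have "Cauchy (\<lambda>n. r n *\<^sub>R t)"
      using s by (intro LIMSEQ_imp_Cauchy) (rule tendsto_scaleR, auto)
    then have "Cauchy (\<lambda>n. f n - r n *\<^sub>R t)" 
    proof (intro metric_CauchyI)
      fix e :: real assume "e > 0"
      then have "e / 2 > 0" by simp
      then obtain M N where MN: "\<forall>m\<ge>M. \<forall>n\<ge>M. dist (f m) (f n) < e / 2"
          "\<forall>m\<ge>N. \<forall>n\<ge>N. dist (r m *\<^sub>R t) (r n *\<^sub>R t) < e / 2"
        using metric_CauchyD[OF C] metric_CauchyD[OF \<open>Cauchy (\<lambda>n. r n *\<^sub>R t)\<close>] by metis
      have tri: "dist (f m - r m *\<^sub>R t) (f n - r n *\<^sub>R t) \<le> dist (f m) (f n) + dist (r m *\<^sub>R t) (r n *\<^sub>R t)" for m n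
        using norm_triangle_ineq4[of "f m - f n" "r m *\<^sub>R t - r n *\<^sub>R t"] by (simp add: dist_norm algebra_simps)
      have "dist (f m - r m *\<^sub>R t) (f n - r n *\<^sub>R t) < e" if "m \<ge> max M N" "n \<ge> max M N" for m n
      proof -
        have "dist (f m) (f n) < e / 2" "dist (r m *\<^sub>R t) (r n *\<^sub>R t) < e / 2"
          using that MN by auto
        then show ?thesis using tri[of m n] by linarith
      qed
      then show "\<exists>M. \<forall>m\<ge>M. \<forall>n\<ge>M. dist (f m - r m *\<^sub>R t) (f n - r n *\<^sub>R t) < e" by blast
    qed
    then obtain w where w: "w \<in> W" "(\<lambda>n. f n - r n *\<^sub>R t) \<longlonglongrightarrow> w"
      using W(1)[unfolded complete_def, rule_format, of "\<lambda>n. f n - r n *\<^sub>R t"] r by metis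
    have "(\<lambda>n. (f n - r n *\<^sub>R t) + r n *\<^sub>R t) \<longlonglongrightarrow> w + s *\<^sub>R t"
      by (rule tendsto_add[OF w(2) tendsto_scaleR[OF s tendsto_const]])
    moreover have "w + s *\<^sub>R t \<in> span (insert t W)" unfolding sp using w by (simp, intro exI[of _ s]) simp
    ultimately show "\<exists>l\<in>span (insert t W). f \<longlonglongrightarrow> l" by (simp, blast)
  qed
qed

lemma complete_span_finite:
  fixes S :: "'a::real_normed_vector set"
  assumes "finite S" shows "complete (span S)"
  using assms
proof (induction S)
  case empty
  then show ?case by (simp add: compact_imp_complete)
next
  case (insert t S)
  have "span (insert t S) = span (insert t (span S))"
  proof (rule antisym)
    show "span (insert t S) \<subseteq> span (insert t (span S))"
      by (rule span_mono) (use span_superset in blast)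
    show "span (insert t (span S)) \<subseteq> span (insert t S)"
      by (rule span_minimal) (auto intro: span_base span_mono[THEN subsetD])
  qed
  then show ?case using complete_span_insert[OF insert.IH] by simp
qed

text \<open>Differentiation in the parameter respects sums and multiples in the argument, and
  derivatives are unique. The hypothesis gives \<open>L'\<close> for each fixed \<open>v\<close>
  separately, so its linearity in \<open>v\<close> has to be derived.\<close>

lemma linear_derivative_parameter:
  fixes L :: "'b::real_normed_vector \<Rightarrow> 'a::real_vector \<Rightarrow> 'c::real_normed_vector"
  assumes lin: "eventually (\<lambda>x. linear (L x)) (nhds x0)"
    and L: "\<And>v. ((\<lambda>x. L x v) has_derivative L' v) (at x0)"
  shows "linear (\<lambda>v. L' v h)"
proof -
  have lin0: "linear (L x0)" using lin eventually_nhds_x_imp_x by blast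
  show ?thesis
  proof (rule linearI)
    fix u v
    have "((\<lambda>x. L x u + L x v) has_derivative (\<lambda>h. L' u h + L' v h)) (at x0)"
      by (intro has_derivative_add L)
    then have "((\<lambda>x. L x (u + v)) has_derivative (\<lambda>h. L' u h + L' v h)) (at x0)"
      by (rule has_derivative_transform_eventually)
         (use lin lin0 in \<open>auto simp: linear_add eventually_at_filter elim!: eventually_mono\<close>)
    then show "L' (u + v) h = L' u h + L' v h"
      using has_derivative_unique[OF L] by metis
  next
    fix r u
    have "((\<lambda>x. r *\<^sub>R L x u) has_derivative (\<lambda>h. r *\<^sub>R L' u h)) (at x0)"
      by (intro has_derivative_scaleR_right L)
    then have "((\<lambda>x. L x (r *\<^sub>R u)) has_derivative (\<lambda>h. r *\<^sub>R L' u h)) (at x0)"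
      by (rule has_derivative_transform_eventually)
         (use lin lin0 in \<open>auto simp: linear_scale eventually_at_filter elim!: eventually_mono\<close>)
    then show "L' (r *\<^sub>R u) h = r *\<^sub>R L' u h"
      using has_derivative_unique[OF L] by metis
  qed
qed

text \<open>A basis replaces an inner product on the model space; dimension zero is the case of
  empty \<open>Bs\<close>.\<close>

locale finite_dim_normed =
  fixes Bs :: "'a::real_normed_vector set"
  assumes fin: "finite Bs" and indep: "independent Bs" and spans: "span Bs = UNIV"
begin

abbreviation coord :: "'a \<Rightarrow> 'a \<Rightarrow> real" where
  "coord b v \<equiv> representation Bs v b"

lemma coord_sum: "(\<Sum>b\<in>Bs. coord b v *\<^sub>R b) = v"
  by (rule sum_representation_eq[OF indep]) (auto simp: spans fin)

lemma linear_coord: "linear (coord b)"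
  by (rule linearI) (simp_all add: representation_add[OF indep] representation_scale[OF indep] spans)

text \<open>The coordinate at \<open>b\<close> is the coefficient of \<open>b\<close> modulo the
  span of the other basis vectors. That span is complete, so the separation bound gives the constant
  \<open>inverse \<delta>\<close>.\<close>

lemma bounded_linear_coord: "bounded_linear (coord b)"
proof (cases "b \<in> Bs")
  case True
  have "b \<notin> span (Bs - {b})" using indep True dependent_def by blast
  then obtain \<delta> where d: "\<delta> > 0" "\<And>w r. w \<in> span (Bs - {b}) \<Longrightarrow> \<delta> * \<bar>r\<bar> \<le> norm (w + r *\<^sub>R b)"
    using complete_subspace_separation[of "span (Bs - {b})" b] complete_span_finite fin by blast
  show ?thesis
  proof (rule bounded_linear_intro[where K = "inverse \<delta>"])
    fix x
    have "(\<Sum>b'\<in>Bs - {b}. coord b' x *\<^sub>R b') \<in> span (Bs - {b})"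
      by (intro span_sum span_scale span_base)
    from d(2)[OF this, of "coord b x"]
    have "\<delta> * \<bar>coord b x\<bar> \<le> norm ((\<Sum>b'\<in>Bs - {b}. coord b' x *\<^sub>R b') + coord b x *\<^sub>R b)" .
    also have "(\<Sum>b'\<in>Bs - {b}. coord b' x *\<^sub>R b') + coord b x *\<^sub>R b = x"
      using coord_sum[of x] sum.remove[OF fin True, of "\<lambda>b'. coord b' x *\<^sub>R b'"] by (metis add.commute)
    finally show "norm (coord b x) \<le> norm x * inverse \<delta>" using d by (simp add: field_simps)
  next
    show "coord b (x + y) = coord b x + coord b y" for x y by (rule linear_add[OF linear_coord])
    show "coord b (r *\<^sub>R x) = r *\<^sub>R coord b x" for r x by (rule linear_scale[OF linear_coord])
  qed
next
  case False
  then have "coord b = (\<lambda>_. 0)" using representation_ne_zero by fastforce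
  then show ?thesis by simp
qed

lemma linear_expand: "linear f \<Longrightarrow> f v = (\<Sum>b\<in>Bs. coord b v *\<^sub>R f b)"
  by (subst (1) coord_sum[of v, symmetric]) (simp add: linear_sum linear_scale)

text \<open>No operator norm is needed: pointwise differentiability suffices by expanding in a basis.\<close>

lemma has_derivative_apply:
  fixes L :: "'b::real_normed_vector \<Rightarrow> 'a \<Rightarrow> 'c::real_normed_vector"
  assumes lin: "eventually (\<lambda>x. linear (L x)) (nhds x0)"
    and L: "\<And>v. ((\<lambda>x. L x v) has_derivative L' v) (at x0)"
    and w: "(w has_derivative w') (at x0)"
  shows "((\<lambda>x. L x (w x)) has_derivative (\<lambda>h. L' (w x0) h + L x0 (w' h))) (at x0)"
proof -
  have lin0: "linear (L x0)" using lin eventually_nhds_x_imp_x by blast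
  have "linear (\<lambda>v. L' v h)" for h by (rule linear_derivative_parameter[OF lin L])
  note lin' = linear_expand[OF this]
  have "((\<lambda>x. \<Sum>b\<in>Bs. coord b (w x) *\<^sub>R L x b) has_derivative
     (\<lambda>h. \<Sum>b\<in>Bs. coord b (w x0) *\<^sub>R L' b h + coord b (w' h) *\<^sub>R L x0 b)) (at x0)"
    by (intro has_derivative_sum has_derivative_scaleR L bounded_linear.has_derivative[OF bounded_linear_coord] w)
  moreover have "(\<lambda>h. \<Sum>b\<in>Bs. coord b (w x0) *\<^sub>R L' b h + coord b (w' h) *\<^sub>R L x0 b)
      = (\<lambda>h. L' (w x0) h + L x0 (w' h))"
    by (rule ext) (subst (2) lin', subst linear_expand[OF lin0, of "w' _"], simp add: sum.distrib)
  ultimately have "((\<lambda>x. \<Sum>b\<in>Bs. coord b (w x) *\<^sub>R L x b) has_derivative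
     (\<lambda>h. L' (w x0) h + L x0 (w' h))) (at x0)" by simp
  then show ?thesis
    by (rule has_derivative_transform_eventually)
       (use lin lin0 in \<open>auto simp: eventually_at_filter linear_expand[symmetric] elim!: eventually_mono\<close>)
qed

text \<open>The rule \<open>has_derivative_apply\<close> used twice: first with the second argument
  frozen, then with the second argument moving as well.\<close>

lemma has_derivative_apply2:
  fixes \<beta> :: "'b::real_normed_vector \<Rightarrow> 'a \<Rightarrow> 'a \<Rightarrow> 'c::real_normed_vector"
  assumes bil: "eventually (\<lambda>x. bilinear (\<beta> x)) (nhds x0)"
    and \<beta>: "\<And>u v. ((\<lambda>x. \<beta> x u v) has_derivative \<beta>' u v) (at x0)"
    and u: "(u has_derivative u') (at x0)" and v: "(v has_derivative v') (at x0)"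
  shows "((\<lambda>x. \<beta> x (u x) (v x)) has_derivative
    (\<lambda>h. \<beta>' (u x0) (v x0) h + \<beta> x0 (u' h) (v x0) + \<beta> x0 (u x0) (v' h))) (at x0)"
proof (rule has_derivative_apply)
  show "eventually (\<lambda>x. linear (\<beta> x (u x))) (nhds x0)"
    using bil by eventually_elim (simp add: bilinear_def)
  show "((\<lambda>x. \<beta> x (u x) w) has_derivative (\<lambda>h. \<beta>' (u x0) w h + \<beta> x0 (u' h) w)) (at x0)" for w
  proof (rule has_derivative_apply)
    show "eventually (\<lambda>x. linear (\<lambda>y. \<beta> x y w)) (nhds x0)"
      using bil by eventually_elim (simp add: bilinear_def)
  qed (use \<beta> u in auto)
qed (use v in auto)

lemma has_derivative_bilinear:
  fixes \<beta> :: "'a \<Rightarrow> 'a \<Rightarrow> 'c::real_normed_vector"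
  assumes "bilinear \<beta>"
    and "(u has_derivative u') (at x0)" "(v has_derivative v') (at x0)"
  shows "((\<lambda>x. \<beta> (u x) (v x)) has_derivative (\<lambda>h. \<beta> (u' h) (v x0) + \<beta> (u x0) (v' h))) (at x0)"
  using has_derivative_apply2[of "\<lambda>_. \<beta>" x0 "\<lambda>_ _ _. 0", OF _ _ assms(2,3)] assms(1) by simp

end

section \<open>Symmetry of the second derivative\<close>

text \<open>The second difference is the increment over \<open>{0..s}\<close> of a difference of
  \<open>f\<close> along two parallel segments. Its derivative in \<open>t\<close> is controlled by
  the differentiability at \<open>x\<close> of the derivative in direction \<open>v\<close>, and the
  mean value inequality finishes the estimate.\<close>

lemma second_difference_bound:
  fixes f :: "'a::real_normed_vector \<Rightarrow> 'b::real_normed_vector"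
  assumes S: "open S" "x \<in> S" and f: "\<And>y. y \<in> S \<Longrightarrow> f differentiable (at y)"
    and D: "((\<lambda>y. frechet_derivative f (at y) v) has_derivative D) (at x)" and e: "e > 0"
  obtains d where "d > 0" "\<And>s. \<lbrakk>0 < s; s < d\<rbrakk> \<Longrightarrow>
    norm (f (x + s *\<^sub>R u + s *\<^sub>R v) - f (x + s *\<^sub>R u) - f (x + s *\<^sub>R v) + f x - (s * s) *\<^sub>R D u) \<le> e * (s * s)"
proof -
  \<comment> \<open>All points used have the form \<open>x + a *\<^sub>R u + t *\<^sub>R v\<close>
    with \<open>a\<close> and \<open>t\<close> in \<open>{0..s}\<close>, hence lie within
    \<open>s * K\<close> of \<open>x\<close>; the summand 1 keeps \<open>K\<close> positive.\<close>
  define K where "K = norm u + norm v + 1"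
  have K: "K > 0" by (simp add: K_def add_nonneg_pos)
  \<comment> \<open>Chosen so that \<open>2 * e' * (s * K) * s\<close> equals
    \<open>e * (s * s)\<close>.\<close>
  define e' where "e' = e / (2 * K)"
  have e': "e' > 0" using e K by (simp add: e'_def)
  obtain r where r: "r > 0" "ball x r \<subseteq> S" using S openE by blast
  define g where "g y = frechet_derivative f (at y) v" for y
  have linD: "linear D" using D has_derivative_linear by blast
  obtain d1 where d1: "d1 > 0" "\<And>y. norm (y - x) < d1 \<Longrightarrow> norm (g y - g x - D (y - x)) \<le> e' * norm (y - x)"
    using D e' unfolding has_derivative_at_alt g_def by blast
  define d where "d = min d1 r / K"
  have d: "d > 0" using d1 r K by (simp add: d_def)
  have main: "norm (f (x + s *\<^sub>R u + s *\<^sub>R v) - f (x + s *\<^sub>R u) - f (x + s *\<^sub>R v) + f x - (s * s) *\<^sub>R D u) \<le> e * (s * s)"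
    if s: "0 < s" "s < d" for s
  proof -
    have sK: "s * K < min d1 r" using s K unfolding d_def by (simp add: field_simps)
    have nm: "norm (a *\<^sub>R u + t *\<^sub>R v) \<le> s * K" if "0 \<le> a" "a \<le> s" "0 \<le> t" "t \<le> s" for a t
    proof -
      have "norm (a *\<^sub>R u + t *\<^sub>R v) \<le> a * norm u + t * norm v"
        using norm_triangle_ineq[of "a *\<^sub>R u" "t *\<^sub>R v"] that by simp
      also have "\<dots> \<le> s * norm u + s * norm v" using that by (intro add_mono mult_right_mono) auto
      also have "\<dots> \<le> s * K" using s by (simp add: K_def algebra_simps)
      finally show ?thesis .
    qed
    have fd: "((\<lambda>t. f (x + a *\<^sub>R u + t *\<^sub>R v)) has_derivative (\<lambda>h. h *\<^sub>R g (x + a *\<^sub>R u + t *\<^sub>R v))) (at t within {0..s})"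
      if "0 \<le> a" "a \<le> s" "0 \<le> t" "t \<le> s" for a t
    proof -
      have "x + a *\<^sub>R u + t *\<^sub>R v \<in> S"
      proof (rule subsetD[OF r(2)])
        have "dist x (x + a *\<^sub>R u + t *\<^sub>R v) = norm (a *\<^sub>R u + t *\<^sub>R v)"
          by (metis add.assoc add_diff_cancel_left' dist_commute dist_norm)
        then show "x + a *\<^sub>R u + t *\<^sub>R v \<in> ball x r" using nm[OF that] sK by simp
      qed
      then have df: "(f has_derivative frechet_derivative f (at (x + a *\<^sub>R u + t *\<^sub>R v))) (at (x + a *\<^sub>R u + t *\<^sub>R v))"
        using f frechet_derivative_works by blast
      have "((\<lambda>t. x + a *\<^sub>R u + t *\<^sub>R v) has_derivative (\<lambda>h. h *\<^sub>R v)) (at t within {0..s})"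
        by (auto intro!: derivative_eq_intros)
      from has_derivative_compose[OF this df]
      show ?thesis using has_derivative_linear[OF df] by (simp add: g_def linear_scale)
    qed
    \<comment> \<open>The expected main term is subtracted, so \<open>F'\<close> is a difference of
      two remainders of the linear approximation \<open>D\<close>. The summand
      \<open>0 *\<^sub>R u\<close> gives both segments the shape treated in
      \<open>fd\<close>.\<close>
    define F where "F t = f (x + s *\<^sub>R u + t *\<^sub>R v) - f (x + 0 *\<^sub>R u + t *\<^sub>R v) - (s * t) *\<^sub>R D u" for t
    define F' where "F' t = g (x + s *\<^sub>R u + t *\<^sub>R v) - g (x + 0 *\<^sub>R u + t *\<^sub>R v) - s *\<^sub>R D u" for t
    have "norm (F s - F 0) \<le> (2 * e' * (s * K)) * norm (s - 0)"
    proof (rule differentiable_bound)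
      show "convex {0..s}" by simp
      show "s \<in> {0..s}" "0 \<in> {0..s}" using s by auto
      fix t assume t: "t \<in> {0..s}"
      show "(F has_derivative (\<lambda>h. h *\<^sub>R F' t)) (at t within {0..s})"
        unfolding F_def F'_def
        apply (rule has_derivative_eq_rhs)
         apply (rule has_derivative_diff[OF has_derivative_diff[OF fd fd]])
                 apply (use s t in auto)
        by (auto intro!: derivative_eq_intros simp: algebra_simps)
      have b: "norm (g (x + a *\<^sub>R u + t *\<^sub>R v) - g x - D (a *\<^sub>R u + t *\<^sub>R v)) \<le> e' * (s * K)"
        if "0 \<le> a" "a \<le> s" for a
      proof -
        have "norm (a *\<^sub>R u + t *\<^sub>R v) \<le> s * K" using nm that t by auto
        moreover have "norm (g (x + a *\<^sub>R u + t *\<^sub>R v) - g x - D (a *\<^sub>R u + t *\<^sub>R v)) \<le> e' * norm (a *\<^sub>R u + t *\<^sub>R v)"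
          using d1(2)[of "x + a *\<^sub>R u + t *\<^sub>R v"] calculation sK by (simp add: add.assoc)
        ultimately show ?thesis using e' by (meson dual_order.trans less_imp_le mult_left_mono)
      qed
      have "F' t = (g (x + s *\<^sub>R u + t *\<^sub>R v) - g x - D (s *\<^sub>R u + t *\<^sub>R v))
          - (g (x + 0 *\<^sub>R u + t *\<^sub>R v) - g x - D (0 *\<^sub>R u + t *\<^sub>R v))"
        using linD by (simp add: F'_def linear_add linear_scale)
      then have "norm (F' t) \<le> e' * (s * K) + e' * (s * K)"
        using b[of s] b[of 0] s norm_triangle_ineq4 by (smt (verit, best))
      then have "norm (F' t) \<le> 2 * e' * (s * K)" by linarith
      from mult_right_mono[OF this, of "norm h" for h :: real]
      have "norm (h *\<^sub>R F' t) \<le> 2 * e' * (s * K) * norm h" for h :: real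
        by (simp add: mult.commute)
      then show "onorm (\<lambda>h. h *\<^sub>R F' t) \<le> 2 * e' * (s * K)" by (rule onorm_le)
    qed
    also have "(2 * e' * (s * K)) * norm (s - 0) = e * (s * s)"
      using s K by (simp add: e'_def)
    finally show ?thesis by (simp add: F_def algebra_simps)
  qed
  show thesis using that[OF d main] .
qed

text \<open>The second difference is symmetric in \<open>u\<close> and \<open>v\<close>, and divided
  by \<open>s * s\<close> it is arbitrarily close to both mixed derivatives.\<close>

lemma second_derivative_symmetric:
  fixes f :: "'a::real_normed_vector \<Rightarrow> 'b::real_normed_vector"
  assumes S: "open S" "x \<in> S" and f: "\<And>y. y \<in> S \<Longrightarrow> f differentiable (at y)"
    and Du: "((\<lambda>y. frechet_derivative f (at y) u) has_derivative Du) (at x)"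
    and Dv: "((\<lambda>y. frechet_derivative f (at y) v) has_derivative Dv) (at x)"
  shows "Dv u = Du v"
proof -
  have "norm (Dv u - Du v) \<le> 0 + e" if e: "e > 0" for e
  proof -
    have e2: "e / 2 > 0" using e by simp
    obtain d1 where d1: "d1 > 0" "\<And>s. \<lbrakk>0 < s; s < d1\<rbrakk> \<Longrightarrow>
      norm (f (x + s *\<^sub>R u + s *\<^sub>R v) - f (x + s *\<^sub>R u) - f (x + s *\<^sub>R v) + f x - (s * s) *\<^sub>R Dv u) \<le> e / 2 * (s * s)"
      using second_difference_bound[OF S f Dv e2] by blast
    obtain d2 where d2: "d2 > 0" "\<And>s. \<lbrakk>0 < s; s < d2\<rbrakk> \<Longrightarrow>
      norm (f (x + s *\<^sub>R v + s *\<^sub>R u) - f (x + s *\<^sub>R v) - f (x + s *\<^sub>R u) + f x - (s * s) *\<^sub>R Du v) \<le> e / 2 * (s * s)"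
      using second_difference_bound[OF S f Du e2] by blast
    define s where "s = min d1 d2 / 2"
    have s: "s > 0" "s < d1" "s < d2" using d1 d2 by (auto simp: s_def)
    let ?q = "f (x + s *\<^sub>R u + s *\<^sub>R v) - f (x + s *\<^sub>R u) - f (x + s *\<^sub>R v) + f x"
    have q: "f (x + s *\<^sub>R v + s *\<^sub>R u) - f (x + s *\<^sub>R v) - f (x + s *\<^sub>R u) + f x = ?q"
      by (simp add: algebra_simps)
    have "(s * s) *\<^sub>R (Dv u - Du v) = (?q - (s * s) *\<^sub>R Du v) - (?q - (s * s) *\<^sub>R Dv u)"
      by (simp add: algebra_simps)
    then have "norm ((s * s) *\<^sub>R (Dv u - Du v)) \<le> e / 2 * (s * s) + e / 2 * (s * s)"
      using d1(2)[OF s(1,2)] d2(2)[OF s(1,3)] unfolding q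
      by (smt (verit, best) norm_triangle_ineq4)
    then have "(s * s) * norm (Dv u - Du v) \<le> (s * s) * e" unfolding norm_scaleR by (simp add: mult.commute[of e])
    then show ?thesis using s by simp
  qed
  then have "norm (Dv u - Du v) \<le> 0" by (rule field_le_epsilon)
  then show ?thesis by simp
qed

section \<open>Inner products as bilinear forms\<close>

locale inner_form =
  fixes \<beta> :: "'e::real_vector \<Rightarrow> 'e \<Rightarrow> real"
  assumes bil: "bilinear \<beta>" and sym: "\<beta> u v = \<beta> v u" and pos: "u \<noteq> 0 \<Longrightarrow> 0 < \<beta> u u"
begin

lemma linear_left: "linear (\<lambda>u. \<beta> u v)" and linear_right: "linear (\<beta> u)"
  using bil by (auto simp: bilinear_def)

lemmas form_simps = linear_add[OF linear_left] linear_add[OF linear_right]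
  linear_scale[OF linear_left, simplified] linear_scale[OF linear_right, simplified]
  linear_diff[OF linear_left] linear_diff[OF linear_right]
  linear_sum[OF linear_left] linear_sum[OF linear_right]
  linear_0[OF linear_left] linear_0[OF linear_right]

lemma nonneg: "0 \<le> \<beta> u u"
  using pos[of u] by (cases "u = 0") (auto simp: form_simps)

lemma zero_iff: "\<beta> u u = 0 \<longleftrightarrow> u = 0"
  using pos[of u] linear_0[OF linear_left] by force

lemma eqI: "(\<And>w. \<beta> u w = \<beta> v w) \<Longrightarrow> u = v"
  using zero_iff[of "u - v"] by (simp add: form_simps)

text \<open>The projection \<open>p\<close> of the new vector is subtracted. If nothing remains, the
  old basis already spans; otherwise the normalised remainder is added.\<close>

lemma gram_schmidt:
  assumes "finite S"
  shows "\<exists>B. finite B \<and> span B = span S \<and> (\<forall>u\<in>B. \<forall>v\<in>B. \<beta> u v = (if u = v then 1 else 0))"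
  using assms
proof (induction S)
  case empty
  then show ?case by (intro exI[of _ "{}"]) simp
next
  case (insert x S)
  then obtain B where B: "finite B" "span B = span S"
    and on: "\<And>u v. \<lbrakk>u \<in> B; v \<in> B\<rbrakk> \<Longrightarrow> \<beta> u v = (if u = v then 1 else 0)" by blast
  define p where "p = (\<Sum>e\<in>B. \<beta> x e *\<^sub>R e)"
  define y where "y = x - p"
  have p: "p \<in> span B" unfolding p_def by (intro span_sum span_scale span_base)
  have orth: "\<beta> y f = 0" if "f \<in> B" for f
  proof -
    have "\<beta> p f = (\<Sum>e\<in>B. if e = f then \<beta> x e else 0)"
      unfolding p_def form_simps using that by (intro sum.cong) (auto simp: on)
    also have "\<dots> = \<beta> x f" using B that by simp
    finally show ?thesis by (simp add: y_def form_simps)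
  qed
  have "span (insert x S) = span (insert x B)"
    using span_insert[of x S] span_insert[of x B] B by simp
  moreover have "span (insert x B) = span (insert y B)"
  proof -
    have "x \<in> span (insert y B)"
      using span_add[of y "insert y B" p] p span_mono[of B "insert y B"] by (auto simp: y_def span_base)
    moreover have "y \<in> span (insert x B)"
      unfolding y_def using p span_mono[of B "insert x B"] by (intro span_diff) (auto simp: span_base)
    ultimately show ?thesis
      by (intro antisym span_minimal) (auto intro: span_base)
  qed
  ultimately have sp: "span (insert x S) = span (insert y B)" by simp
  show ?case
  proof (cases "y = 0")
    case True
    have "span (insert y B) = span B" using True by (simp add: span_insert_0)
    then show ?thesis using B on sp by auto
  next
    case False
    define n where "n = sqrt (\<beta> y y)"
    have n: "n > 0" "n * n = \<beta> y y" using pos[OF False] by (auto simp: n_def)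
    define z where "z = inverse n *\<^sub>R y"
    have "\<beta> z z = 1" using n pos[OF False] by (simp add: z_def form_simps field_simps)
    moreover have "\<beta> z f = 0" "\<beta> f z = 0" if "f \<in> B" for f
      using orth[OF that] by (simp_all add: z_def form_simps sym[of f])
    ultimately have "\<forall>u\<in>insert z B. \<forall>v\<in>insert z B. \<beta> u v = (if u = v then 1 else 0)"
      using on by (metis insert_iff zero_neq_one)
    moreover have "span (insert z B) = span (insert y B)"
    proof -
      have "y = n *\<^sub>R z" using n by (simp add: z_def)
      then have "y \<in> span (insert z B)" using span_scale span_base by (metis insertI1)
      moreover have "z \<in> span (insert y B)" unfolding z_def by (intro span_scale span_base) simp
      ultimately show ?thesis by (intro antisym span_minimal) (auto intro: span_base)
    qed
    ultimately show ?thesis using sp B(1) by (intro exI[of _ "insert z B"]) simp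
  qed
qed

lemma orthonormal_basis_exists:
  assumes "finite (S :: 'e set)" "span S = UNIV"
  shows "\<exists>B. orthonormal_basis \<beta> B"
  using gram_schmidt[OF assms(1)] assms(2) unfolding orthonormal_basis_def by metis

section \<open>Expansion in an orthonormal basis and the Levi-Civita connection\<close>

context
  fixes E assumes E: "orthonormal_basis \<beta> E"
begin

lemma fin_E: "finite E" and on_E: "\<lbrakk>e \<in> E; f \<in> E\<rbrakk> \<Longrightarrow> \<beta> e f = (if e = f then 1 else 0)"
  using E by (auto simp: orthonormal_basis_def)

lemma expand: "(\<Sum>e\<in>E. \<beta> v e *\<^sub>R e) = v"
proof -
  have "v \<in> span E" using E by (simp add: orthonormal_basis_def)
  then show ?thesis
  proof (induction rule: span_induct_alt)
    case base
    show ?case by (simp add: form_simps)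
  next
    case (step c x y)
    have "(\<Sum>e\<in>E. \<beta> x e *\<^sub>R e) = (\<Sum>e\<in>E. if e = x then e else 0)"
      using step by (intro sum.cong) (auto simp: on_E)
    also have "\<dots> = x" using step fin_E by simp
    finally have "(\<Sum>e\<in>E. \<beta> x e *\<^sub>R e) = x" .
    moreover have "(\<Sum>e\<in>E. \<beta> (c *\<^sub>R x + y) e *\<^sub>R e) = c *\<^sub>R (\<Sum>e\<in>E. \<beta> x e *\<^sub>R e) + (\<Sum>e\<in>E. \<beta> y e *\<^sub>R e)"
      by (simp add: form_simps scaleR_add_left sum.distrib scaleR_sum_right)
    ultimately show ?case using step.IH by simp
  qed
qed

lemma expand_linear: "linear f \<Longrightarrow> f v = (\<Sum>e\<in>E. \<beta> v e *\<^sub>R f e)"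
  by (subst (1) expand[of v, symmetric]) (simp add: linear_sum linear_scale)

text \<open>Follows by expanding \<open>w\<close> in \<open>E\<close>; it is what turns the scalar
  Koszul expression into a vector-valued map.\<close>

lemma riesz: "linear \<phi> \<Longrightarrow> \<beta> (\<Sum>e\<in>E. \<phi> e *\<^sub>R e) w = \<phi> w"
  by (subst expand_linear[of \<phi> w]) (auto simp: form_simps sym[of w] intro!: sum.cong)

lemma linear_eq_0: "\<lbrakk>linear f; \<And>e. e \<in> E \<Longrightarrow> f e = 0\<rbrakk> \<Longrightarrow> f v = 0"
  by (subst expand_linear[of f v]) auto

text \<open>Compatibility in its three cyclic forms, together with symmetry, determines
  \<open>\<beta> (\<Gamma> u v) w\<close>; conversely \<open>riesz\<close> builds
  \<open>\<Gamma>\<close> from these values. With \<open>D w u v\<close> the derivative of the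
  metric coefficients along \<open>w\<close>, this shows that the definite description in
  \<open>christoffel\<close> denotes.\<close>

lemma levi_civita_ex1:
  fixes D :: "'e \<Rightarrow> 'e \<Rightarrow> 'e \<Rightarrow> real"
  assumes D1: "\<And>u v. linear (\<lambda>w. D w u v)" and D2: "\<And>w. bilinear (D w)"
    and Dsym: "\<And>w u v. D w u v = D w v u"
  shows "\<exists>!\<Gamma>. bilinear \<Gamma> \<and> (\<forall>u v. \<Gamma> u v = \<Gamma> v u) \<and>
    (\<forall>w u v. D w u v = \<beta> (\<Gamma> w u) v + \<beta> u (\<Gamma> w v))"
proof -
  \<comment> \<open>Koszul's formula\<close>
  define K where "K u v w = (D u v w + D v u w - D w u v) / 2" for u v w
  have D3: "linear (D w u)" and D4: "linear (\<lambda>u. D w u v)" for w u v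
    using D2 by (auto simp: bilinear_def)
  note Ds = linear_add[OF D1] linear_add[OF D3] linear_add[OF D4]
    linear_scale[OF D1] linear_scale[OF D3] linear_scale[OF D4]
  have linK: "linear (K u v)" for u v
    by (rule linearI) (simp_all add: K_def Ds field_simps)
  define \<Gamma> where "\<Gamma> u v = (\<Sum>e\<in>E. K u v e *\<^sub>R e)" for u v
  have \<Gamma>: "\<beta> (\<Gamma> u v) w = K u v w" for u v w
    unfolding \<Gamma>_def by (rule riesz[OF linK])
  have uniq: "\<beta> (\<Gamma>' u v) w = K u v w"
    if "\<forall>u v. \<Gamma>' u v = \<Gamma>' v u" "\<forall>w u v. D w u v = \<beta> (\<Gamma>' w u) v + \<beta> u (\<Gamma>' w v)" for \<Gamma>' u v w
  proof -
    have "D u v w = \<beta> (\<Gamma>' u v) w + \<beta> (\<Gamma>' u w) v"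
      "D v u w = \<beta> (\<Gamma>' u v) w + \<beta> (\<Gamma>' v w) u"
      "D w u v = \<beta> (\<Gamma>' u w) v + \<beta> (\<Gamma>' v w) u"
      using that by (metis sym)+
    then show ?thesis by (simp add: K_def)
  qed
  show ?thesis
  proof (rule ex1I[of _ \<Gamma>], intro conjI allI)
    have "linear (\<Gamma> u)" and "linear (\<lambda>u. \<Gamma> u v)" for u v
      by (rule linearI; rule eqI; simp add: form_simps \<Gamma> K_def Ds field_simps)+
    then show "bilinear \<Gamma>" by (simp add: bilinear_def)
    show "\<Gamma> u v = \<Gamma> v u" for u v
      by (simp add: \<Gamma>_def K_def Dsym[of _ v u] add.commute)
    show "D w u v = \<beta> (\<Gamma> w u) v + \<beta> u (\<Gamma> w v)" for w u v
      by (simp add: \<Gamma> sym[of u] K_def Dsym[of _ v u] Dsym[of v w u] Dsym[of u w v] field_simps)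
  next
    fix \<Gamma>'
    assume "bilinear \<Gamma>' \<and> (\<forall>u v. \<Gamma>' u v = \<Gamma>' v u) \<and> (\<forall>w u v. D w u v = \<beta> (\<Gamma>' w u) v + \<beta> u (\<Gamma>' w v))"
    then have "\<beta> (\<Gamma>' u v) w = K u v w" for u v w by (elim conjE) (rule uniq)
    then show "\<Gamma>' = \<Gamma>" by (intro ext eqI) (simp only: \<Gamma>)
  qed
qed

text \<open>
  \<open>C\<close> plays the role of the Levi-Civita connection on left-invariant fields and \<open>N u v\<close> that of the
  Lie bracket. Paired with \<open>X\<close>, the trace hypothesis says that the squared norm of the symmetric
  part of \<open>ad X\<close> is a negative multiple of \<open>\<langle>U, C X X\<rangle>\<close>; summing over an orthonormal basis of
  \<open>X\<close>'s turns the right-hand side into \<open>- \<bar>U\<bar>\<^sup>2\<close>.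
\<close>

lemma bracket_skew:
  fixes C :: "'e \<Rightarrow> 'e \<Rightarrow> 'e"
  assumes C: "bilinear C" and skew: "\<And>w u v. \<beta> (C w u) v + \<beta> u (C w v) = 0"
    and N: "\<And>u v. N u v = C u v - C v u"
    and U: "U = (\<Sum>e\<in>E. C e e)"
    and trace: "\<And>X. (\<Sum>e\<in>E. C (N X e) e + C e (N X e)) = N X U"
  shows "\<beta> (N X u) v + \<beta> u (N X v) = 0"
proof -
  have C1: "linear (\<lambda>u. C u v)" and C2: "linear (C u)" for u v
    using C by (auto simp: bilinear_def)
  have N2: "linear (N X)" for X
    unfolding N by (intro linear_compose_sub C1 C2)
  have N1: "linear (\<lambda>X. N X u)" for u
    unfolding N by (intro linear_compose_sub C1 C2)
  note Ns = linear_add[OF N1] linear_scale[OF N1] linear_add[OF N2] linear_scale[OF N2]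
  \<comment> \<open>\<open>S X\<close> is the bilinear form of \<open>ad X\<close> plus its
    transpose, which has to vanish.\<close>
  define S where "S X u v = \<beta> (N X u) v + \<beta> u (N X v)" for X u v
  have sk: "\<beta> (C w u) v = - \<beta> u (C w v)" for w u v using skew[of w u v] by linarith
  \<comment> \<open>Only the skewness of \<open>C\<close> and its relation to \<open>N\<close> enter
    here. Summed over \<open>e\<close>, the right-hand side becomes the left-hand side of the trace
    hypothesis paired with \<open>X\<close>.\<close>
  have key: "\<beta> (N X e) (N X e) + \<beta> e (N X (N X e)) = \<beta> (C (N X e) e + C e (N X e)) X" for X e
  proof -
    have "\<beta> (C (N X e) e) X = - \<beta> e (C X (N X e)) + \<beta> e (N X (N X e))"
      unfolding sk by (simp add: N[of X "N X e"] form_simps)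
    moreover have "- \<beta> e (C X (N X e)) = \<beta> (C X e) (N X e)" unfolding sk by simp
    moreover have "\<beta> (C e (N X e)) X = - \<beta> (C e X) (N X e)" 
      using sk[of e "N X e" X] by (simp add: sym)
    ultimately show ?thesis by (simp add: form_simps N[of X e])
  qed
  \<comment> \<open>The expansions \<open>a\<close> and \<open>b\<close> reduce the double sums to
    single ones; \<open>key\<close> and the trace hypothesis then leave
    \<open>2 * \<beta> (N X U) X\<close>.\<close>
  have sq: "(\<Sum>e\<in>E. \<Sum>f\<in>E. (S X e f)\<^sup>2) = - 2 * \<beta> U (C X X)" for X
  proof -
    have a: "(\<Sum>f\<in>E. \<beta> (N X e) f * \<beta> (N X e) f) = \<beta> (N X e) (N X e)" for e
      using expand_linear[OF linear_right, of "N X e" "N X e"] by simp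
    have b: "(\<Sum>f\<in>E. \<beta> (N X e) f * \<beta> e (N X f)) = \<beta> e (N X (N X e))" for e
      using expand_linear[OF linear_compose[OF N2 linear_right], of e X "N X e"] by (simp add: o_def)
    have "(\<Sum>e\<in>E. \<Sum>f\<in>E. (S X e f)\<^sup>2)
      = (\<Sum>e\<in>E. \<Sum>f\<in>E. \<beta> (N X e) f * \<beta> (N X e) f) + (\<Sum>e\<in>E. \<Sum>f\<in>E. \<beta> e (N X f) * \<beta> e (N X f))
       + 2 * (\<Sum>e\<in>E. \<Sum>f\<in>E. \<beta> (N X e) f * \<beta> e (N X f))"
      unfolding S_def power2_sum by (simp add: power2_eq_square sum.distrib sum_distrib_left mult.assoc)
    also have "(\<Sum>e\<in>E. \<Sum>f\<in>E. \<beta> e (N X f) * \<beta> e (N X f)) = (\<Sum>e\<in>E. \<Sum>f\<in>E. \<beta> (N X e) f * \<beta> (N X e) f)"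
      by (subst sum.swap) (simp add: sym)
    also have "(\<Sum>e\<in>E. \<Sum>f\<in>E. \<beta> (N X e) f * \<beta> (N X e) f) + (\<Sum>e\<in>E. \<Sum>f\<in>E. \<beta> (N X e) f * \<beta> (N X e) f)
        + 2 * (\<Sum>e\<in>E. \<Sum>f\<in>E. \<beta> (N X e) f * \<beta> e (N X f))
      = 2 * (\<Sum>e\<in>E. \<beta> (N X e) (N X e) + \<beta> e (N X (N X e)))"
      unfolding a b by (simp add: sum.distrib)
    also have "\<dots> = 2 * \<beta> (N X U) X"
      unfolding key by (simp only: trace[symmetric] form_simps)
    \<comment> \<open>As \<open>C U\<close> is skew, \<open>\<beta> (C U X) X\<close> is zero, so
      only the part \<open>C X U\<close> of \<open>N X U\<close> contributes.\<close>
    also have "\<beta> (N X U) X = - \<beta> U (C X X)"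
      using sk[of U X X] by (simp add: N form_simps sk[of X U] sym[of X])
    finally show ?thesis by simp
  qed
  \<comment> \<open>Summing \<open>C X X\<close> over the basis reproduces \<open>U\<close>, so a
    sum of squares equals \<open>- 2 * \<beta> U U\<close> and both sides are zero.\<close>
  have "(\<Sum>X\<in>E. \<Sum>e\<in>E. \<Sum>f\<in>E. (S X e f)\<^sup>2) = - 2 * \<beta> U U"
    unfolding sq by (subst (2) U) (simp add: form_simps sum_distrib_left)
  also have "\<dots> \<le> 0" using nonneg by simp
  finally have "(\<Sum>X\<in>E. \<Sum>e\<in>E. \<Sum>f\<in>E. (S X e f)\<^sup>2) = 0"
    by (intro antisym sum_nonneg) auto
  then have z0: "S X e f = 0" if "X \<in> E" "e \<in> E" "f \<in> E" for X e f
    using that fin_E by (simp add: sum_nonneg_eq_0_iff sum_nonneg)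
  have linS: "linear (\<lambda>X. S X u v)" "linear (\<lambda>u. S X u v)" "linear (S X u)" for X u v
    unfolding S_def by (rule linearI; simp add: form_simps Ns algebra_simps)+
  \<comment> \<open>Vanishing on basis vectors is extended to all vectors, one argument at a
    time.\<close>
  have z1: "S X e f = 0" if "e \<in> E" "f \<in> E" for X e f
    by (rule linear_eq_0[OF linS(1)]) (rule z0[OF _ that])
  have z2: "S X u f = 0" if "f \<in> E" for X u f
    by (rule linear_eq_0[OF linS(2)]) (rule z1[OF _ that])
  have "S X u v = 0"
    by (rule linear_eq_0[OF linS(3)]) (rule z2)
  then show ?thesis by (simp add: S_def)
qed

end
end

section \<open>Second-order calculus of a local group\<close>

lemma has_derivative_eventually_cong:
  assumes "(f has_derivative f') (at x)" "eventually (\<lambda>y. f y = g y) (nhds x)"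
  shows "(g has_derivative f') (at x)"
  using has_derivative_transform_eventually[OF assms(1)] assms(2) eventually_nhds_x_imp_x[OF assms(2)]
  by (simp add: eventually_at_filter eventually_mono)

lemma has_derivative_eventually_unique:
  assumes "(f has_derivative f') (at x)" "(g has_derivative g') (at x)"
    and "eventually (\<lambda>y. f y = g y) (nhds x)"
  shows "f' = g'"
  using has_derivative_eventually_cong[OF assms(1,3)] assms(2) has_derivative_unique by blast

lemma eventually_nhds_continuous:
  assumes "isCont f x" "eventually P (nhds (f x))"
  shows "eventually (\<lambda>y. P (f y)) (nhds x)"
  using assms eventually_compose_filterlim[of P "nhds (f x)" f "nhds x"]
  by (simp add: continuous_at_imp_continuous_at_within tendsto_at_iff_tendsto_nhds isCont_def)

text \<open>The group law read in a chart around the identity \<open>x0\<close>. What is recorded is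
  second-order differentiability at \<open>(x0, x0)\<close> and the two unit laws near
  \<open>x0\<close>.\<close>

locale local_group = finite_dim_normed Bs for Bs :: "'a::real_normed_vector set" +
  fixes m :: "'a \<times> 'a \<Rightarrow> 'a" and W :: "('a \<times> 'a) set" and x0 :: 'a
  assumes openW: "open W" and x0W: "(x0, x0) \<in> W"
    and diff_m: "\<And>z. z \<in> W \<Longrightarrow> m differentiable (at z)"
    and diff2_m: "\<And>V. (\<lambda>z. frechet_derivative m (at z) V) differentiable (at (x0, x0))"
    and right_unit: "eventually (\<lambda>x. m (x, x0) = x) (nhds x0)"
    and left_unit: "eventually (\<lambda>x. m (x0, x) = x) (nhds x0)"
begin

definition Dm :: "'a \<times> 'a \<Rightarrow> 'a \<times> 'a \<Rightarrow> 'a" where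
  "Dm z = frechet_derivative m (at z)"

text \<open>The first argument \<open>V\<close> is the direction of the inner derivative; the second
  is the direction in which that derivative is differentiated again.\<close>

definition D2m :: "'a \<times> 'a \<Rightarrow> 'a \<times> 'a \<Rightarrow> 'a" where
  "D2m V = frechet_derivative (\<lambda>z. Dm z V) (at (x0, x0))"

definition mult2 :: "'a \<Rightarrow> 'a \<Rightarrow> 'a" where
  "mult2 u v = D2m (0, v) (u, 0)"

section \<open>First and second derivatives of the multiplication at the identity\<close>

lemma Dm: "z \<in> W \<Longrightarrow> (m has_derivative Dm z) (at z)"
  using diff_m frechet_derivative_works unfolding Dm_def by blast

lemma D2m: "((\<lambda>z. Dm z V) has_derivative D2m V) (at (x0, x0))"
  using diff2_m frechet_derivative_works unfolding Dm_def D2m_def by blast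

lemma linear_Dm: "z \<in> W \<Longrightarrow> linear (Dm z)"
  using Dm has_derivative_linear by blast

lemma linear_D2m: "linear (D2m V)"
  using D2m has_derivative_linear by blast

lemma eventually_W: "eventually (\<lambda>z. z \<in> W) (nhds (x0, x0))"
  using openW x0W eventually_nhds by blast

lemma eventually_W_left: "eventually (\<lambda>x. (x, x0) \<in> W) (nhds x0)"
  and eventually_W_right: "eventually (\<lambda>x. (x0, x) \<in> W) (nhds x0)"
  using eventually_nhds_continuous[where f = "\<lambda>x. (x, x0)" and x = x0, OF _ eventually_W]
    eventually_nhds_continuous[where f = "\<lambda>x. (x0, x)" and x = x0, OF _ eventually_W] by simp_all

lemma linear_D2m_left: "linear (\<lambda>V. D2m V U)"
  by (rule linear_derivative_parameter[OF _ D2m]) (use eventually_W linear_Dm in \<open>auto elim: eventually_mono\<close>)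

lemma Dm_along:
  assumes "(p has_derivative p') (at x1)" "p x1 \<in> W"
  shows "((\<lambda>x. m (p x)) has_derivative (\<lambda>h. Dm (p x1) (p' h))) (at x1)"
  using has_derivative_compose[OF assms(1) Dm[OF assms(2)]] .

text \<open>The unit law is differentiated at every point near \<open>x0\<close>, not just at
  \<open>x0\<close>, because the resulting identity is differentiated once more.\<close>

lemma Dm_left: "eventually (\<lambda>x. \<forall>u. Dm (x, x0) (u, 0) = u) (nhds x0)"
proof -
  have "eventually (\<lambda>x. eventually (\<lambda>x. m (x, x0) = x) (nhds x)) (nhds x0)"
    using right_unit eventually_eventually by blast
  then show ?thesis using eventually_W_left
  proof eventually_elim
    case (elim x)
    have "((\<lambda>x. m (x, x0)) has_derivative (\<lambda>u. Dm (x, x0) (u, 0))) (at x)"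
      by (rule Dm_along) (use elim in \<open>auto intro!: derivative_eq_intros\<close>)
    from has_derivative_eventually_unique[OF this has_derivative_ident elim(1)]
    show ?case by metis
  qed
qed

lemma Dm_right: "eventually (\<lambda>x. \<forall>u. Dm (x0, x) (0, u) = u) (nhds x0)"
proof -
  have "eventually (\<lambda>x. eventually (\<lambda>x. m (x0, x) = x) (nhds x)) (nhds x0)"
    using left_unit eventually_eventually by blast
  then show ?thesis using eventually_W_right
  proof eventually_elim
    case (elim x)
    have "((\<lambda>x. m (x0, x)) has_derivative (\<lambda>u. Dm (x0, x) (0, u))) (at x)"
      by (rule Dm_along) (use elim in \<open>auto intro!: derivative_eq_intros\<close>)
    from has_derivative_eventually_unique[OF this has_derivative_ident elim(1)]
    show ?case by metis
  qed
qed

lemma Dm_x0: "Dm (x0, x0) (u, v) = u + v"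
proof -
  have "Dm (x0, x0) ((u, 0) + (0, v)) = u + v"
    unfolding linear_add[OF linear_Dm[OF x0W]]
    using eventually_nhds_x_imp_x[OF Dm_left] eventually_nhds_x_imp_x[OF Dm_right] by simp
  then show ?thesis by simp
qed

lemma D2m_along:
  assumes "(p has_derivative p') (at x1)" "p x1 = (x0, x0)"
  shows "((\<lambda>x. Dm (p x) V) has_derivative (\<lambda>h. D2m V (p' h))) (at x1)"
  using has_derivative_compose[OF assms(1), of "\<lambda>z. Dm z V" "D2m V"] D2m assms(2) by simp

text \<open>The derivative in direction \<open>(v, 0)\<close> is constant along the slice of points
  \<open>(x, x0)\<close>. Thus the pure second derivatives vanish and only the mixed one,
  \<open>mult2\<close>, survives.\<close>

lemma D2m_left: "D2m (v, 0) (u, 0) = 0"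
proof -
  have "((\<lambda>x. Dm (x, x0) (v, 0)) has_derivative (\<lambda>h. D2m (v, 0) (h, 0))) (at x0)"
    by (rule D2m_along) (auto intro!: derivative_eq_intros)
  then have "(\<lambda>h. D2m (v, 0) (h, 0)) = (\<lambda>h. 0)"
    by (rule has_derivative_eventually_unique[OF _ has_derivative_const])
       (use Dm_left in \<open>auto elim: eventually_mono\<close>)
  then show ?thesis by metis
qed

lemma D2m_right: "D2m (0, v) (0, u) = 0"
proof -
  have "((\<lambda>x. Dm (x0, x) (0, v)) has_derivative (\<lambda>h. D2m (0, v) (0, h))) (at x0)"
    by (rule D2m_along) (auto intro!: derivative_eq_intros)
  then have "(\<lambda>h. D2m (0, v) (0, h)) = (\<lambda>h. 0)"
    by (rule has_derivative_eventually_unique[OF _ has_derivative_const])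
       (use Dm_right in \<open>auto elim: eventually_mono\<close>)
  then show ?thesis by metis
qed

lemma D2m_symmetric: "D2m U V = D2m V U"
  using second_derivative_symmetric[OF openW x0W diff_m] D2m unfolding Dm_def by blast

lemma D2m_left_right: "D2m (v, 0) (u, u') = mult2 v u'"
proof -
  have "D2m (v, 0) ((u, 0) + (0, u')) = mult2 v u'"
    unfolding linear_add[OF linear_D2m] mult2_def D2m_left by (simp add: D2m_symmetric)
  then show ?thesis by simp
qed

lemma D2m_right_left: "D2m (0, v) (u, u') = mult2 u v"
proof -
  have "D2m (0, v) ((u, 0) + (0, u')) = mult2 u v"
    unfolding linear_add[OF linear_D2m] mult2_def D2m_right by simp
  then show ?thesis by simp
qed

lemma bilinear_mult2: "bilinear mult2"
  unfolding bilinear_def mult2_def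
proof (intro conjI allI)
  fix u v
  have "linear (\<lambda>v::'a. (0::'a, v))" "linear (\<lambda>u::'a. (u, 0::'a))"
    by (auto intro!: linearI)
  then show "linear (\<lambda>v. D2m (0, v) (u, 0))" "linear (\<lambda>u. D2m (0, v) (u, 0))"
    using linear_compose[OF _ linear_D2m_left, of "\<lambda>v. (0, v)" "(u, 0)"]
      linear_compose[OF _ linear_D2m, of "\<lambda>u. (u, 0)" "(0, v)"] by (auto simp: o_def)
qed

lemma mult2_minus: "mult2 u (- v) = - mult2 u v"
  using bilinear_mult2 unfolding bilinear_def by (simp add: linear_neg)

definition bracket :: "'a \<Rightarrow> 'a \<Rightarrow> 'a" where
  "bracket u v = mult2 u v - mult2 v u"

text \<open>
  In coordinates \<open>a x a\<inverse> = m(a, m(x, \<iota> a))\<close>, and \<open>Dm (a, \<iota> a) (0, Dm (x0, \<iota> a) (v, 0))\<close> is its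
  derivative at the identity: the adjoint representation, whose derivative in \<open>a\<close> is the bracket.
\<close>

lemma derivative_Ad:
  assumes \<iota>: "(\<iota> has_derivative \<iota>') (at x0)" "\<iota> x0 = x0"
    and inv: "eventually (\<lambda>x. m (x, \<iota> x) = x0) (nhds x0)"
  shows "((\<lambda>a. Dm (a, \<iota> a) (0, Dm (x0, \<iota> a) (v, 0))) has_derivative (\<lambda>X. bracket X v)) (at x0)"
proof -
  have pair: "((\<lambda>x. (x, \<iota> x)) has_derivative (\<lambda>h. (h, \<iota>' h))) (at x0)"
    by (rule has_derivative_Pair[OF has_derivative_ident \<iota>(1)])
  have "((\<lambda>x. m (x, \<iota> x)) has_derivative (\<lambda>h. Dm (x0, x0) (h, \<iota>' h))) (at x0)"
    using has_derivative_compose[OF pair, of m "Dm (x0, x0)"] Dm[OF x0W] \<iota>(2) by simp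
  \<comment> \<open>Differentiating \<open>m (x, \<iota> x) = x0\<close> shows that inversion has
    derivative minus the identity.\<close>
  from has_derivative_eventually_unique[OF this has_derivative_const inv]
  have "h + \<iota>' h = 0" for h unfolding Dm_x0 by metis
  then have \<iota>': "\<iota>' = (\<lambda>h. - h)" by (metis eq_neg_iff_add_eq_0 add.commute)
  \<comment> \<open>Product rule for two linear maps depending on \<open>a\<close>: the base point
    of the outer one moves by \<open>(h, - h)\<close>, that of the inner one by
    \<open>(0, - h)\<close>. The two contributions are \<open>mult2 h v\<close> and
    \<open>- mult2 v h\<close>.\<close>
  have "((\<lambda>a. Dm (a, \<iota> a) (0, Dm (x0, \<iota> a) (v, 0))) has_derivative
     (\<lambda>h. D2m (0, Dm (x0, \<iota> x0) (v, 0)) (h, - h) + Dm (x0, \<iota> x0) (0, D2m (v, 0) (0, - h)))) (at x0)"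
  proof (rule has_derivative_apply[where L = "\<lambda>a y. Dm (a, \<iota> a) (0, y)"])
    have "isCont (\<lambda>x. (x, \<iota> x)) x0" using pair has_derivative_continuous by blast
    then have "eventually (\<lambda>x. (x, \<iota> x) \<in> W) (nhds x0)"
      by (rule eventually_nhds_continuous) (use \<iota> eventually_W in simp)
    then show "eventually (\<lambda>x. linear (\<lambda>y. Dm (x, \<iota> x) (0, y))) (nhds x0)"
    proof eventually_elim
      case (elim x)
      have "linear (\<lambda>v::'a. (0::'a, v))" by (auto intro!: linearI)
      from linear_compose[OF this linear_Dm[OF elim]] show ?case by (simp add: o_def)
    qed
    show "((\<lambda>x. Dm (x, \<iota> x) (0, v)) has_derivative (\<lambda>h. D2m (0, v) (h, - h))) (at x0)" for v
      by (rule D2m_along) (use pair \<iota> \<iota>' in auto)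
    show "((\<lambda>x. Dm (x0, \<iota> x) (v, 0)) has_derivative (\<lambda>h. D2m (v, 0) (0, - h))) (at x0)"
      by (rule D2m_along) (use \<iota> \<iota>' in \<open>auto intro!: derivative_eq_intros\<close>)
  qed
  then show ?thesis
    unfolding \<iota>(2) Dm_x0 D2m_right_left D2m_left_right mult2_minus bracket_def by simp
qed

text \<open>Differentiate \<open>f (m (x, y)) = m (f x, f y)\<close> in \<open>y\<close> at
  \<open>x0\<close> for each nearby \<open>x\<close>, and then the resulting identity in
  \<open>x\<close> at \<open>x0\<close>.\<close>

lemma second_derivative_hom:
  assumes S: "open S" "x0 \<in> S" and f: "\<And>x. x \<in> S \<Longrightarrow> f differentiable (at x)"
    and f2: "\<And>v. (\<lambda>x. frechet_derivative f (at x) v) differentiable (at x0)"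
    and f0: "f x0 = x0"
    and hom: "eventually (\<lambda>(x, y). f (m (x, y)) = m (f x, f y)) (nhds (x0, x0))"
  defines "F \<equiv> frechet_derivative f (at x0)"
  shows "frechet_derivative (\<lambda>x. frechet_derivative f (at x) v) (at x0) u = mult2 (F u) (F v) - F (mult2 u v)"
proof -
  define Df where "Df x = frechet_derivative f (at x)" for x
  have Df: "(f has_derivative Df x) (at x)" if "x \<in> S" for x
    using f[OF that] frechet_derivative_works unfolding Df_def by blast
  have evS: "eventually (\<lambda>x. x \<in> S) (nhds x0)" using S eventually_nhds by blast
  have F: "F = Df x0" by (simp add: F_def Df_def)
  have contf: "isCont f x0" using Df[OF S(2)] has_derivative_continuous by blast
  \<comment> \<open>A neighbourhood of the pair contains a rectangle, which allows differentiation
    in \<open>y\<close> with \<open>x\<close> held fixed.\<close>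
  have "eventually (\<lambda>x. eventually (\<lambda>y. f (m (x, y)) = m (f x, f y)) (nhds x0)) (nhds x0)"
  proof -
    obtain P Q where P: "eventually P (nhds x0)" and Q: "eventually Q (nhds x0)"
      and PQ: "\<And>x y. \<lbrakk>P x; Q y\<rbrakk> \<Longrightarrow> f (m (x, y)) = m (f x, f y)"
      using hom unfolding nhds_prod eventually_prod_filter by auto
    show ?thesis using P by eventually_elim (rule eventually_mono[OF Q], rule PQ)
  qed
  moreover have "eventually (\<lambda>x. (f x, x0) \<in> W) (nhds x0)"
    by (rule eventually_nhds_continuous[OF contf]) (use eventually_W_left f0 in simp)
  ultimately have ev: "eventually (\<lambda>x. Df x (Dm (x, x0) (0, v)) = Dm (f x, x0) (0, F v)) (nhds x0)"
    using eventually_W_left right_unit evS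
  proof eventually_elim
    case (elim x)
    have "((\<lambda>y. m (x, y)) has_derivative (\<lambda>v. Dm (x, x0) (0, v))) (at x0)"
      by (rule Dm_along) (use elim in \<open>auto intro!: derivative_eq_intros\<close>)
    then have 1: "((\<lambda>y. f (m (x, y))) has_derivative (\<lambda>v. Df x (Dm (x, x0) (0, v)))) (at x0)"
      by (rule has_derivative_compose) (use Df[OF elim(5)] elim(4) in simp)
    have "((\<lambda>y. m (f x, f y)) has_derivative (\<lambda>v. Dm (f x, f x0) (0, F v))) (at x0)"
      by (rule Dm_along) (use elim Df[OF S(2)] F f0 in \<open>auto intro!: derivative_eq_intros\<close>)
    then have 2: "((\<lambda>y. m (f x, f y)) has_derivative (\<lambda>v. Dm (f x, x0) (0, F v))) (at x0)"
      by (simp add: f0)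
    from has_derivative_eventually_unique[OF 1 2 elim(1)] show ?case by metis
  qed
  have 1: "((\<lambda>x. Df x (Dm (x, x0) (0, v))) has_derivative
     (\<lambda>h. frechet_derivative (\<lambda>x. Df x (Dm (x0, x0) (0, v))) (at x0) h + Df x0 (D2m (0, v) (h, 0)))) (at x0)"
  proof (rule has_derivative_apply[where L' = "\<lambda>v. frechet_derivative (\<lambda>x. Df x v) (at x0)"])
    show "eventually (\<lambda>x. linear (Df x)) (nhds x0)"
      using evS by eventually_elim (use Df has_derivative_linear in blast)
    show "((\<lambda>x. Df x v) has_derivative frechet_derivative (\<lambda>x. Df x v) (at x0)) (at x0)" for v
      using f2 frechet_derivative_works unfolding Df_def by blast
    show "((\<lambda>x. Dm (x, x0) (0, v)) has_derivative (\<lambda>h. D2m (0, v) (h, 0))) (at x0)"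
      by (rule D2m_along) (auto intro!: derivative_eq_intros)
  qed
  have 2: "((\<lambda>x. Dm (f x, x0) (0, F v)) has_derivative (\<lambda>h. D2m (0, F v) (F h, 0))) (at x0)"
    by (rule D2m_along) (use Df[OF S(2)] F f0 in \<open>auto intro!: derivative_eq_intros\<close>)
  have "(\<lambda>h. frechet_derivative (\<lambda>x. Df x (Dm (x0, x0) (0, v))) (at x0) h + Df x0 (D2m (0, v) (h, 0)))
      = (\<lambda>h. D2m (0, F v) (F h, 0))"
    by (rule has_derivative_eventually_unique[OF 1 2 ev])
  then have "frechet_derivative (\<lambda>x. Df x v) (at x0) u + F (mult2 u v) = mult2 (F u) (F v)"
    unfolding Dm_x0 D2m_right_left F by (simp add: fun_eq_iff)
  then show ?thesis unfolding Df_def by (simp add: eq_diff_eq)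
qed

text \<open>The left-invariant field through \<open>u\<close> is \<open>Dm (x, x0) (0, u)\<close>,
  with derivative \<open>mult2 w u\<close> along \<open>w\<close> at \<open>x0\<close>;
  differentiating the invariance of \<open>\<gamma>\<close> along such fields gives the
  formula.\<close>

lemma derivative_left_invariant_form:
  fixes \<gamma> :: "'a \<Rightarrow> 'a \<Rightarrow> 'a \<Rightarrow> real"
  assumes bil: "eventually (\<lambda>x. bilinear (\<gamma> x)) (nhds x0)"
    and \<gamma>': "\<And>u v. ((\<lambda>x. \<gamma> x u v) has_derivative \<gamma>' u v) (at x0)"
    and inv: "eventually (\<lambda>x. \<gamma> x (Dm (x, x0) (0, u)) (Dm (x, x0) (0, v)) = \<gamma> x0 u v) (nhds x0)"
  shows "\<gamma>' u v w = - \<gamma> x0 (mult2 w u) v - \<gamma> x0 u (mult2 w v)"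
proof -
  have D: "((\<lambda>x. Dm (x, x0) (0, v)) has_derivative (\<lambda>h. D2m (0, v) (h, 0))) (at x0)" for v
    by (rule D2m_along) (auto intro!: derivative_eq_intros)
  from has_derivative_eventually_unique[OF has_derivative_apply2[OF bil \<gamma>' D D] has_derivative_const inv]
  have "\<gamma>' u v w + \<gamma> x0 (mult2 w u) v + \<gamma> x0 u (mult2 w v) = 0"
    unfolding Dm_x0 D2m_right_left by (simp add: fun_eq_iff)
  then show ?thesis by simp
qed

end

section \<open>The infinitesimal theorem: harmonic conjugations force a skew adjoint action\<close>

context local_group
begin

text \<open>Reduces the geometry to \<open>bracket_skew\<close>. Here \<open>F\<close> stands for
  \<open>Ad\<close> in coordinates, \<open>\<Gamma>\<close> for the Christoffel symbols at the
  identity, and \<open>trace\<close> for the vanishing of the tension there.\<close>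

lemma adjoint_skew:
  fixes \<gamma> :: "'a \<Rightarrow> 'a \<Rightarrow> 'a \<Rightarrow> real" and F :: "'a \<Rightarrow> 'a \<Rightarrow> 'a"
  assumes \<gamma>: "eventually (\<lambda>x. inner_form (\<gamma> x)) (nhds x0)"
    and diff: "\<And>u v. (\<lambda>x. \<gamma> x u v) differentiable (at x0)"
    and inv: "\<And>u v. eventually (\<lambda>x. \<gamma> x (Dm (x, x0) (0, u)) (Dm (x, x0) (0, v)) = \<gamma> x0 u v) (nhds x0)"
    and E: "orthonormal_basis (\<gamma> x0) E"
    and F0: "\<And>v. F x0 v = v" and linF: "eventually (\<lambda>a. linear (F a)) (nhds x0)"
    and F': "\<And>v. ((\<lambda>a. F a v) has_derivative (\<lambda>X. bracket X v)) (at x0)"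
  defines "\<Gamma> \<equiv> (THE \<Gamma>. bilinear \<Gamma> \<and> (\<forall>u v. \<Gamma> u v = \<Gamma> v u) \<and>
        (\<forall>w u v. frechet_derivative (\<lambda>x. \<gamma> x u v) (at x0) w = \<gamma> x0 (\<Gamma> w u) v + \<gamma> x0 u (\<Gamma> w v)))"
  assumes trace: "eventually (\<lambda>a. (\<Sum>e\<in>E. mult2 (F a e) (F a e) - F a (mult2 e e) + \<Gamma> (F a e) (F a e) - F a (\<Gamma> e e)) = 0) (nhds x0)"
  shows "\<gamma> x0 (bracket X u) v + \<gamma> x0 u (bracket X v) = 0"
proof -
  interpret inner_form "\<gamma> x0" by (rule eventually_nhds_x_imp_x[OF \<gamma>])
  have bil\<gamma>: "eventually (\<lambda>x. bilinear (\<gamma> x)) (nhds x0)"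
    using \<gamma> by eventually_elim (rule inner_form.bil)
  define D where "D w u v = frechet_derivative (\<lambda>x. \<gamma> x u v) (at x0) w" for w u v
  have D: "((\<lambda>x. \<gamma> x u v) has_derivative (\<lambda>w. D w u v)) (at x0)" for u v
    using diff frechet_derivative_works unfolding D_def by blast
  have "linear (D w u)" for w u
    by (rule linear_derivative_parameter[OF _ D]) (use bil\<gamma> in \<open>auto simp: bilinear_def elim: eventually_mono\<close>)
  moreover have "linear (\<lambda>u. D w u v)" for w v
    by (rule linear_derivative_parameter[where L = "\<lambda>x u. \<gamma> x u v", OF _ D])
       (use bil\<gamma> in \<open>auto simp: bilinear_def elim: eventually_mono\<close>)
  ultimately have D2: "bilinear (D w)" for w by (simp add: bilinear_def)
  have D1: "linear (\<lambda>w. D w u v)" for u v using D has_derivative_linear by blast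
  have "(\<lambda>w. D w u v) = (\<lambda>w. D w v u)" for u v
    by (rule has_derivative_eventually_unique[OF D D])
       (rule eventually_mono[OF \<gamma>], rule inner_form.sym)
  then have "D w u v = D w v u" for w u v by metis
  from levi_civita_ex1[where D = D, OF E D1 D2 this]
  have "\<exists>!\<Gamma>. bilinear \<Gamma> \<and> (\<forall>u v. \<Gamma> u v = \<Gamma> v u) \<and>
    (\<forall>w u v. D w u v = \<gamma> x0 (\<Gamma> w u) v + \<gamma> x0 u (\<Gamma> w v))" .
  from theI'[OF this, folded \<Gamma>_def[folded D_def]]
  have \<Gamma>: "bilinear \<Gamma>" and \<Gamma>_sym: "\<And>u v. \<Gamma> u v = \<Gamma> v u"
    and \<Gamma>_D: "\<And>w u v. D w u v = \<gamma> x0 (\<Gamma> w u) v + \<gamma> x0 u (\<Gamma> w v)"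
    by blast+
  \<comment> \<open>The covariant derivative at the identity of the left-invariant field through
    \<open>v\<close>: its coordinate derivative along \<open>u\<close> is
    \<open>mult2 u v\<close>.\<close>
  define C where "C u v = \<Gamma> u v + mult2 u v" for u v
  have C: "bilinear C" unfolding C_def using \<Gamma> bilinear_mult2
    by (auto simp: bilinear_def intro!: linear_compose_add)
  have skew: "\<gamma> x0 (C w u) v + \<gamma> x0 u (C w v) = 0" for w u v
    using derivative_left_invariant_form[OF bil\<gamma> D inv, of w u v]
    by (simp add: \<Gamma>_D C_def form_simps)
  define U where "U = (\<Sum>e\<in>E. C e e)"
  have bound: "bracket u v = C u v - C v u" for u v
    by (simp add: bracket_def C_def \<Gamma>_sym[of u v])
  have "((\<lambda>a. \<Sum>e\<in>E. C (F a e) (F a e)) has_derivative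
      (\<lambda>X. \<Sum>e\<in>E. C (bracket X e) (F x0 e) + C (F x0 e) (bracket X e))) (at x0)"
    by (intro has_derivative_sum has_derivative_bilinear C F')
  \<comment> \<open>The four terms of the trace combine to
    \<open>C (F a e) (F a e) - F a (C e e)\<close>. Both sides of the resulting equation are
    differentiated at \<open>x0\<close>, where \<open>F\<close> is the identity.\<close>
  moreover have "eventually (\<lambda>a. (\<Sum>e\<in>E. C (F a e) (F a e)) = F a U) (nhds x0)"
    using trace linF
  proof eventually_elim
    case (elim a)
    have "(\<Sum>e\<in>E. C (F a e) (F a e)) - F a U = (\<Sum>e\<in>E. C (F a e) (F a e) - F a (C e e))"
      using elim(2) by (simp add: U_def linear_sum sum_subtractf)
    also have "\<dots> = (\<Sum>e\<in>E. mult2 (F a e) (F a e) - F a (mult2 e e) + \<Gamma> (F a e) (F a e) - F a (\<Gamma> e e))"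
      using elim(2) by (intro sum.cong) (auto simp: C_def linear_add)
    finally show ?case using elim(1) by simp
  qed
  ultimately have "(\<lambda>X. \<Sum>e\<in>E. C (bracket X e) (F x0 e) + C (F x0 e) (bracket X e)) = (\<lambda>X. bracket X U)"
    by (rule has_derivative_eventually_unique[OF _ F'])
  then have "(\<Sum>e\<in>E. C (bracket X e) e + C e (bracket X e)) = bracket X U" for X
    unfolding F0 by metis
  from bracket_skew[OF E C skew bound U_def this] show ?thesis .
qed

end

section \<open>Charts and differentiable maps\<close>

text \<open>Openness of the chart map on open subsets of its domain takes the place of the
  homeomorphism; it transports neighbourhoods into coordinates and passes directly to product
  charts.\<close>

definition chart_on :: "'p topology \<Rightarrow> ('p, 'e::real_normed_vector) chart \<Rightarrow> bool" where
  "chart_on T c \<longleftrightarrow> openin T (fst c) \<and> inj_on (snd c) (fst c) \<and>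
     (\<forall>U. openin T U \<longrightarrow> U \<subseteq> fst c \<longrightarrow> open (snd c ` U))"

definition atlas_on :: "'p topology \<Rightarrow> ('p, 'e::real_normed_vector) chart set \<Rightarrow> bool" where
  "atlas_on T A \<longleftrightarrow> (\<Union>c\<in>A. fst c) = topspace T \<and> (\<forall>c\<in>A. chart_on T c)"

lemma chart_inv_left: "\<lbrakk>chart_on T c; p \<in> fst c\<rbrakk> \<Longrightarrow> chart_inv c (snd c p) = p"
  by (simp add: chart_on_def chart_inv_def inv_into_f_f)

lemma local_rep_apply: "\<lbrakk>chart_on T c; p \<in> fst c\<rbrakk> \<Longrightarrow> local_rep c d \<phi> (snd c p) = snd d (\<phi> p)"
  by (simp add: local_rep_def chart_inv_left)

lemma chart_subset: "chart_on T c \<Longrightarrow> fst c \<subseteq> topspace T"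
  by (simp add: chart_on_def openin_subset)

text \<open>The image of \<open>U \<inter> fst c\<close> is an open neighbourhood of
  \<open>snd c p\<close>. This is how facts about points near \<open>p\<close> become facts about
  nearby coordinates.\<close>

lemma eventually_chart:
  assumes "chart_on T c" "openin T U" "p \<in> U" "p \<in> fst c"
    and "\<And>q. \<lbrakk>q \<in> U; q \<in> fst c\<rbrakk> \<Longrightarrow> P (snd c q)"
  shows "eventually P (nhds (snd c p))"
proof -
  have "open (snd c ` (U \<inter> fst c))" using assms(1,2) by (simp add: chart_on_def openin_Int)
  then show ?thesis unfolding eventually_nhds using assms(3-5) by blast
qed

lemma open_chart_image:
  assumes "chart_on T c" "chart_on T' d" "continuous_map T T' \<phi>"
  shows "open (snd c ` (fst c \<inter> \<phi> -` fst d))"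
proof -
  have "openin T (fst c \<inter> {p \<in> topspace T. \<phi> p \<in> fst d})"
    using assms by (intro openin_Int openin_continuous_map_preimage[OF assms(3)]) (auto simp: chart_on_def)
  moreover have "fst c \<inter> {p \<in> topspace T. \<phi> p \<in> fst d} = fst c \<inter> \<phi> -` fst d"
    using chart_subset[OF assms(1)] by blast
  ultimately show ?thesis using assms(1) by (simp add: chart_on_def)
qed

lemma atlas_chart: "\<lbrakk>atlas_on T A; c \<in> charts_at A p\<rbrakk> \<Longrightarrow> chart_on T c"
  by (simp add: atlas_on_def charts_at_def)

lemma atlas_charts_at: "\<lbrakk>atlas_on T A; p \<in> topspace T\<rbrakk> \<Longrightarrow> \<exists>c. c \<in> charts_at A p"
  unfolding atlas_on_def charts_at_def by blast

lemma charts_at_mem: "c \<in> charts_at A p \<Longrightarrow> p \<in> fst c" "c \<in> charts_at A p \<Longrightarrow> c \<in> A"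
  by (auto simp: charts_at_def)

lemma charts_at_topspace: "\<lbrakk>atlas_on T A; c \<in> charts_at A p\<rbrakk> \<Longrightarrow> p \<in> topspace T"
  by (rule subsetD[OF chart_subset[OF atlas_chart] charts_at_mem(1)])

definition chart_deriv ::
  "('p, 'e::real_normed_vector) chart \<Rightarrow> ('q, 'f::real_normed_vector) chart \<Rightarrow> ('p \<Rightarrow> 'q) \<Rightarrow> 'p \<Rightarrow> 'e \<Rightarrow> 'f" where
  "chart_deriv c d \<phi> p = frechet_derivative (local_rep c d \<phi>) (at (snd c p))"

text \<open>A first-order notion for which closure under composition and pairing needs just the
  ordinary chain rule; translations and conjugations are obtained in this way.\<close>

definition differentiable_map ::
  "'p topology \<Rightarrow> ('p, 'e::real_normed_vector) chart set \<Rightarrow>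
   'q topology \<Rightarrow> ('q, 'f::real_normed_vector) chart set \<Rightarrow> ('p \<Rightarrow> 'q) \<Rightarrow> bool" where
  "differentiable_map T A T' A' \<phi> \<longleftrightarrow> continuous_map T T' \<phi> \<and>
     (\<forall>p. \<forall>c\<in>charts_at A p. \<forall>d\<in>charts_at A' (\<phi> p). local_rep c d \<phi> differentiable (at (snd c p)))"

section \<open>Chain rule for maps between manifolds\<close>

lemma chart_deriv:
  "\<lbrakk>differentiable_map T A T' A' \<phi>; c \<in> charts_at A p; d \<in> charts_at A' (\<phi> p)\<rbrakk> \<Longrightarrow>
    (local_rep c d \<phi> has_derivative chart_deriv c d \<phi> p) (at (snd c p))"
  unfolding chart_deriv_def frechet_derivative_works[symmetric] by (simp add: differentiable_map_def)

lemma chart_deriv_eqI: "(local_rep c d \<phi> has_derivative D) (at (snd c p)) \<Longrightarrow> chart_deriv c d \<phi> p = D"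
  unfolding chart_deriv_def by (rule frechet_derivative_at[symmetric])

lemma differentiable_map_continuous: "differentiable_map T A T' A' \<phi> \<Longrightarrow> continuous_map T T' \<phi>"
  by (simp add: differentiable_map_def)

lemma differentiable_map_topspace:
  "\<lbrakk>differentiable_map T A T' A' \<phi>; p \<in> topspace T\<rbrakk> \<Longrightarrow> \<phi> p \<in> topspace T'"
  by (auto simp: differentiable_map_def continuous_map_def)

lemma differentiable_mapI:
  assumes "continuous_map T T' \<phi>" "atlas_on T A"
    and "\<And>p c d. \<lbrakk>p \<in> topspace T; c \<in> charts_at A p; d \<in> charts_at A' (\<phi> p)\<rbrakk> \<Longrightarrow>
      \<exists>D. (local_rep c d \<phi> has_derivative D) (at (snd c p))"
  shows "differentiable_map T A T' A' \<phi>"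
  unfolding differentiable_map_def differentiable_def
  by (intro conjI allI ballI assms(1,3) charts_at_topspace[OF assms(2)])

lemma smooth_on_differentiable:
  assumes "smooth_on S f" "x \<in> S"
  shows "f differentiable (at x)" "(\<lambda>y. frechet_derivative f (at y) v) differentiable (at x)"
proof -
  have "C_k_on (Suc (Suc 0)) S f" using assms(1) unfolding smooth_on_def by blast
  then show "f differentiable (at x)" "(\<lambda>y. frechet_derivative f (at y) v) differentiable (at x)"
    using assms(2) by simp_all
qed

lemma smooth_map_differentiable_map:
  assumes "smooth_map T A T' A' \<phi>"
  shows "differentiable_map T A T' A' \<phi>"
  unfolding differentiable_map_def
proof (intro conjI allI ballI)
  show "continuous_map T T' \<phi>" using assms by (simp add: smooth_map_def)
  fix p c d assume c: "c \<in> charts_at A p" and d: "d \<in> charts_at A' (\<phi> p)"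
  have "smooth_on (snd c ` (fst c \<inter> \<phi> -` fst d)) (local_rep c d \<phi>)"
    using assms charts_at_mem(2)[OF c] charts_at_mem(2)[OF d] by (simp add: smooth_map_def)
  then show "local_rep c d \<phi> differentiable (at (snd c p))"
    by (rule smooth_on_differentiable) (use charts_at_mem(1)[OF c] charts_at_mem(1)[OF d] in blast)
qed

text \<open>Near \<open>p\<close> the local representatives compose through the intermediate chart
  \<open>d\<close>. Allowing any \<open>\<rho>\<close> that agrees with the composite on the space
  makes it possible to factor group maps by algebraic identities.\<close>

lemma chart_derivative_compose:
  assumes A: "atlas_on T A" and A': "atlas_on T' A'"
    and \<phi>: "differentiable_map T A T' A' \<phi>" and \<psi>: "differentiable_map T' A' T'' A'' \<psi>"
    and eq: "\<And>q. q \<in> topspace T \<Longrightarrow> \<rho> q = \<psi> (\<phi> q)"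
    and c: "c \<in> charts_at A p" and d: "d \<in> charts_at A' (\<phi> p)" and e: "e \<in> charts_at A'' (\<psi> (\<phi> p))"
  shows "(local_rep c e \<rho> has_derivative chart_deriv d e \<psi> (\<phi> p) \<circ> chart_deriv c d \<phi> p) (at (snd c p))"
proof (rule has_derivative_eventually_cong)
  note cc = atlas_chart[OF A c] and dd = atlas_chart[OF A' d]
  have eval: "local_rep c d \<phi> (snd c p) = snd d (\<phi> p)"
    by (rule local_rep_apply[OF cc charts_at_mem(1)[OF c]])
  show "((\<lambda>x. local_rep d e \<psi> (local_rep c d \<phi> x)) has_derivative
      chart_deriv d e \<psi> (\<phi> p) \<circ> chart_deriv c d \<phi> p) (at (snd c p))"
    unfolding o_def
    by (rule has_derivative_compose[OF chart_deriv[OF \<phi> c d]])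
       (use chart_deriv[OF \<psi> d e] eval in simp)
  show "eventually (\<lambda>x. local_rep d e \<psi> (local_rep c d \<phi> x) = local_rep c e \<rho> x) (nhds (snd c p))"
  proof (rule eventually_chart[OF cc])
    show "openin T {q \<in> topspace T. \<phi> q \<in> fst d}"
      using differentiable_map_continuous[OF \<phi>] dd
      by (intro openin_continuous_map_preimage) (auto simp: chart_on_def)
    show "p \<in> {q \<in> topspace T. \<phi> q \<in> fst d}" "p \<in> fst c"
      using charts_at_mem(1)[OF c] charts_at_mem(1)[OF d] chart_subset[OF cc] by auto
    show "local_rep d e \<psi> (local_rep c d \<phi> (snd c q)) = local_rep c e \<rho> (snd c q)"
      if "q \<in> {q \<in> topspace T. \<phi> q \<in> fst d}" "q \<in> fst c" for q
      using that by (simp add: local_rep_apply[OF cc] local_rep_apply[OF dd] eq)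
  qed
qed

lemmas chart_deriv_compose = chart_deriv_eqI[OF chart_derivative_compose]

lemma differentiable_map_compose:
  assumes A: "atlas_on T A" and A': "atlas_on T' A'"
    and \<phi>: "differentiable_map T A T' A' \<phi>" and \<psi>: "differentiable_map T' A' T'' A'' \<psi>"
  shows "differentiable_map T A T'' A'' (\<lambda>x. \<psi> (\<phi> x))"
proof (rule differentiable_mapI[OF _ A])
  show "continuous_map T T'' (\<lambda>x. \<psi> (\<phi> x))"
    using continuous_map_compose[OF differentiable_map_continuous[OF \<phi>] differentiable_map_continuous[OF \<psi>]]
    by (simp add: o_def)
  fix p c e assume p: "p \<in> topspace T" and c: "c \<in> charts_at A p" and e: "e \<in> charts_at A'' (\<psi> (\<phi> p))"
  obtain d where d: "d \<in> charts_at A' (\<phi> p)"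
    using atlas_charts_at[OF A'] differentiable_map_topspace[OF \<phi> p] by blast
  show "\<exists>D. (local_rep c e (\<lambda>x. \<psi> (\<phi> x)) has_derivative D) (at (snd c p))"
    by (rule exI, rule chart_derivative_compose[OF A A' \<phi> \<psi> refl c d e])
qed

lemma differentiable_map_const:
  assumes "atlas_on T A" "a \<in> topspace T'"
  shows "differentiable_map T A T' A' (\<lambda>_. a)"
  by (rule differentiable_mapI[OF _ assms(1)])
     (use assms in \<open>auto simp: local_rep_def o_def intro!: exI[of _ "\<lambda>_. 0"]\<close>)

subsection \<open>Products\<close>

text \<open>Each point of an open set in the product lies in an open rectangle inside it, and
  rectangles are mapped onto rectangles.\<close>

lemma chart_on_prod:
  fixes c :: "('p, 'e::real_normed_vector) chart" and d :: "('q, 'f::real_normed_vector) chart"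
  assumes "chart_on T c" "chart_on T' d"
  shows "chart_on (prod_topology T T') (fst c \<times> fst d, map_prod (snd c) (snd d))"
  unfolding chart_on_def
proof (intro conjI allI impI)
  show "openin (prod_topology T T') (fst (fst c \<times> fst d, map_prod (snd c) (snd d)))"
    using assms by (simp add: chart_on_def openin_prod_Times_iff)
  show "inj_on (snd (fst c \<times> fst d, map_prod (snd c) (snd d))) (fst (fst c \<times> fst d, map_prod (snd c) (snd d)))"
    using assms by (auto simp: chart_on_def inj_on_def)
  fix U assume U: "openin (prod_topology T T') U" "U \<subseteq> fst (fst c \<times> fst d, map_prod (snd c) (snd d))"
  have "open (map_prod (snd c) (snd d) ` U)"
    unfolding open_prod_def
  proof
    fix z assume "z \<in> map_prod (snd c) (snd d) ` U"
    then obtain p q where pq: "(p, q) \<in> U" "z = (snd c p, snd d q)" by auto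
    then obtain V V' where V: "openin T V" "openin T' V'" "p \<in> V" "q \<in> V'" "V \<times> V' \<subseteq> U"
      using U(1)[unfolded openin_prod_topology_alt, rule_format, OF pq(1)] by metis
    have "V \<times> V' \<subseteq> fst c \<times> fst d" using V(5) U(2) by simp
    then have "V \<subseteq> fst c" "V' \<subseteq> fst d" using V(3,4) by blast+
    then have "open (snd c ` V)" "open (snd d ` V')" using V assms by (auto simp: chart_on_def)
    moreover have "snd c ` V \<times> snd d ` V' \<subseteq> map_prod (snd c) (snd d) ` U"
      using V(5) image_mono[OF V(5), of "map_prod (snd c) (snd d)"] by (simp add: map_prod_surj_on[OF refl refl])
    ultimately show "\<exists>A B. open A \<and> open B \<and> z \<in> A \<times> B \<and> A \<times> B \<subseteq> map_prod (snd c) (snd d) ` U"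
      using V(3,4) pq(2) by (intro exI[of _ "snd c ` V"] exI[of _ "snd d ` V'"]) simp
  qed
  then show "open (snd (fst c \<times> fst d, map_prod (snd c) (snd d)) ` U)" by simp
qed

lemma charts_at_prod:
  "k \<in> charts_at (prod_atlas A A') (p, q) \<longleftrightarrow>
     (\<exists>c d. c \<in> charts_at A p \<and> d \<in> charts_at A' q \<and> k = (fst c \<times> fst d, map_prod (snd c) (snd d)))"
proof
  assume "k \<in> charts_at (prod_atlas A A') (p, q)"
  then obtain c d where "c \<in> A" "d \<in> A'" "k = (fst c \<times> fst d, map_prod (snd c) (snd d))" "(p, q) \<in> fst k"
    unfolding charts_at_def prod_atlas_def by blast
  then show "\<exists>c d. c \<in> charts_at A p \<and> d \<in> charts_at A' q \<and> k = (fst c \<times> fst d, map_prod (snd c) (snd d))"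
    by (intro exI[of _ c] exI[of _ d]) (simp add: charts_at_def)
next
  assume "\<exists>c d. c \<in> charts_at A p \<and> d \<in> charts_at A' q \<and> k = (fst c \<times> fst d, map_prod (snd c) (snd d))"
  then show "k \<in> charts_at (prod_atlas A A') (p, q)"
    unfolding charts_at_def prod_atlas_def by auto
qed

lemma atlas_on_prod:
  assumes "atlas_on T A" "atlas_on T' A'"
  shows "atlas_on (prod_topology T T') (prod_atlas A A')"
proof -
  have "(\<Union>k\<in>prod_atlas A A'. fst k) = (\<Union>c\<in>A. fst c) \<times> (\<Union>d\<in>A'. fst d)"
  proof (intro equalityI subsetI)
    fix z assume "z \<in> (\<Union>k\<in>prod_atlas A A'. fst k)"
    then obtain c d where "c \<in> A" "d \<in> A'" "z \<in> fst c \<times> fst d"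
      unfolding prod_atlas_def by auto
    then show "z \<in> (\<Union>c\<in>A. fst c) \<times> (\<Union>d\<in>A'. fst d)" by auto
  next
    fix z assume "z \<in> (\<Union>c\<in>A. fst c) \<times> (\<Union>d\<in>A'. fst d)"
    then obtain c d where "c \<in> A" "d \<in> A'" "z \<in> fst c \<times> fst d" by auto
    then show "z \<in> (\<Union>k\<in>prod_atlas A A'. fst k)"
      by (intro UN_I[of "(fst c \<times> fst d, map_prod (snd c) (snd d))"])
         (unfold prod_atlas_def, blast, simp)
  qed
  moreover have "chart_on (prod_topology T T') k" if k: "k \<in> prod_atlas A A'" for k
  proof -
    obtain c d where "c \<in> A" "d \<in> A'" "k = (fst c \<times> fst d, map_prod (snd c) (snd d))"
      using k unfolding prod_atlas_def by blast
    then show ?thesis using chart_on_prod assms by (metis atlas_on_def)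
  qed
  ultimately show ?thesis
    using assms by (simp add: atlas_on_def)
qed

lemma differentiable_map_pair:
  assumes A: "atlas_on T A"
    and \<phi>: "differentiable_map T A T' A' \<phi>" and \<psi>: "differentiable_map T A T'' A'' \<psi>"
  shows "differentiable_map T A (prod_topology T' T'') (prod_atlas A' A'') (\<lambda>x. (\<phi> x, \<psi> x))"
proof (rule differentiable_mapI[OF _ A])
  show "continuous_map T (prod_topology T' T'') (\<lambda>x. (\<phi> x, \<psi> x))"
    using \<phi> \<psi> by (simp add: differentiable_map_def continuous_map_pairedI)
  fix p c k assume p: "p \<in> topspace T" and c: "c \<in> charts_at A p" and k: "k \<in> charts_at (prod_atlas A' A'') (\<phi> p, \<psi> p)"
  then obtain d d' where d: "d \<in> charts_at A' (\<phi> p)" "d' \<in> charts_at A'' (\<psi> p)"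
    and k: "k = (fst d \<times> fst d', map_prod (snd d) (snd d'))" unfolding charts_at_prod by blast
  have "local_rep c k (\<lambda>x. (\<phi> x, \<psi> x)) = (\<lambda>x. (local_rep c d \<phi> x, local_rep c d' \<psi> x))"
    by (auto simp: local_rep_def k)
  then show "\<exists>D. (local_rep c k (\<lambda>x. (\<phi> x, \<psi> x)) has_derivative D) (at (snd c p))"
    using has_derivative_Pair[OF chart_deriv[OF \<phi> c d(1)] chart_deriv[OF \<psi> c d(2)]] by (auto intro: exI)
qed

section \<open>Manifolds and isometries\<close>

lemma smooth_manifold_atlas_on:
  assumes "smooth_manifold T A"
  shows "atlas_on T A"
  unfolding atlas_on_def
proof (intro conjI ballI)
  show "(\<Union>c\<in>A. fst c) = topspace T" using assms by (simp add: smooth_manifold_def)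
  fix c assume "c \<in> A"
  then have c: "openin T (fst c)" "open (snd c ` fst c)"
    and hom: "homeomorphic_map (subtopology T (fst c)) (top_of_set (snd c ` fst c)) (snd c)"
    using assms by (auto simp: smooth_manifold_def)
  show "chart_on T c" unfolding chart_on_def
  proof (intro conjI allI impI c(1))
    have "topspace (subtopology T (fst c)) = fst c" using openin_subset[OF c(1)] by auto
    then show "inj_on (snd c) (fst c)" using homeomorphic_imp_injective_map[OF hom] by simp
    fix U assume "openin T U" "U \<subseteq> fst c"
    then have "openin (subtopology T (fst c)) U" by (simp add: openin_open_subtopology c(1))
    then have "openin (top_of_set (snd c ` fst c)) (snd c ` U)"
      using homeomorphic_imp_open_map[OF hom] unfolding open_map_def by blast
    then show "open (snd c ` U)" using c(2) openin_open_trans by blast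
  qed
qed

text \<open>Continuity of the chart map, used to pull coordinate balls back to the manifold.\<close>

lemma smooth_manifold_openin_chart_preimage:
  assumes "smooth_manifold T A" "c \<in> A" "open B"
  shows "openin T {q \<in> fst c. snd c q \<in> B}"
proof -
  have c: "openin T (fst c)"
    and hom: "homeomorphic_map (subtopology T (fst c)) (top_of_set (snd c ` fst c)) (snd c)"
    using assms by (auto simp: smooth_manifold_def)
  have "openin (top_of_set (snd c ` fst c)) (snd c ` fst c \<inter> B)" using assms(3) by blast
  from openin_continuous_map_preimage[OF homeomorphic_imp_continuous_map[OF hom] this]
  have "openin (subtopology T (fst c)) {q \<in> fst c. snd c q \<in> B}"
    using openin_subset[OF c] by (simp add: Int_absorb1 cong: conj_cong)
  then show ?thesis using c openin_open_subtopology by blast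
qed

locale manifold =
  fixes T :: "'p topology" and A :: "('p, 'e::real_normed_vector) chart set"
  assumes manifold: "smooth_manifold T A"
begin

lemmas atlas = smooth_manifold_atlas_on[OF manifold]
lemmas chart_on = atlas_chart[OF atlas]
lemmas charts_at_ex = atlas_charts_at[OF atlas]
lemmas topspaceI = charts_at_topspace[OF atlas]

lemma differentiable_map_id: "differentiable_map T A T A (\<lambda>x. x)"
proof (rule smooth_map_differentiable_map)
  show "smooth_map T A T A (\<lambda>x. x)"
    using manifold unfolding smooth_map_def smooth_manifold_def by (simp add: vimage_def)
qed

lemmas compose = chart_deriv_compose[OF atlas atlas]

lemma chart_deriv_id:
  assumes "c \<in> charts_at A p"
  shows "chart_deriv c c (\<lambda>x. x) p = (\<lambda>u. u)"
proof (rule chart_deriv_eqI, rule has_derivative_eventually_cong[OF has_derivative_ident])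
  show "eventually (\<lambda>x. x = local_rep c c (\<lambda>x. x) x) (nhds (snd c p))"
    by (rule eventually_chart[OF chart_on[OF assms] openin_topspace topspaceI[OF assms] charts_at_mem(1)[OF assms]])
       (simp add: local_rep_apply[OF chart_on[OF assms]])
qed

lemma linear_chart_deriv:
  "\<lbrakk>differentiable_map T A T A \<phi>; c \<in> charts_at A p; d \<in> charts_at A (\<phi> p)\<rbrakk> \<Longrightarrow> linear (chart_deriv c d \<phi> p)"
  by (rule has_derivative_linear[OF chart_deriv])

lemma coord_tvec_eq:
  "coord_tvec A c p u = (\<lambda>d. if d \<in> charts_at A p then chart_deriv c d (\<lambda>q. q) p u else 0)"
  unfolding coord_tvec_def chart_deriv_def by (rule refl)

lemma coord_tvec_component: "c \<in> charts_at A p \<Longrightarrow> coord_tvec A c p u c = u"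
  by (simp add: coord_tvec_eq chart_deriv_id)

lemma coord_tvec_in_tangent_space:
  assumes c: "c \<in> charts_at A p"
  shows "coord_tvec A c p u \<in> tangent_space A p"
  unfolding tangent_space_def
proof (intro CollectI conjI ballI allI impI)
  fix d d' assume d: "d \<in> charts_at A p" "d' \<in> charts_at A p"
  from compose[OF differentiable_map_id differentiable_map_id _ c d, of "\<lambda>x. x"]
  show "coord_tvec A c p u d' = frechet_derivative (local_rep d d' (\<lambda>q. q)) (at (snd d p)) (coord_tvec A c p u d)"
    using d by (simp add: coord_tvec_eq chart_deriv_def)
qed (simp add: coord_tvec_eq)

lemma tangent_vector_eq:
  assumes "v \<in> tangent_space A p" "c \<in> charts_at A p"
  shows "v = coord_tvec A c p (v c)"
proof
  fix d
  show "v d = coord_tvec A c p (v c) d"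
  proof (cases "d \<in> charts_at A p")
    case True
    then have "v d = frechet_derivative (local_rep c d (\<lambda>q. q)) (at (snd c p)) (v c)"
      using assms unfolding tangent_space_def by blast
    then show ?thesis using True by (simp only: coord_tvec_def if_True)
  next
    case False
    then have "v d = 0" using assms unfolding tangent_space_def by blast
    then show ?thesis using False by (simp add: coord_tvec_def)
  qed
qed

lemma coord_tvec_linear:
  assumes "c \<in> charts_at A p"
  shows "coord_tvec A c p (r *\<^sub>R u + s *\<^sub>R v) = (\<lambda>d. r *\<^sub>R coord_tvec A c p u d + s *\<^sub>R coord_tvec A c p v d)"
proof
  fix d
  show "coord_tvec A c p (r *\<^sub>R u + s *\<^sub>R v) d = r *\<^sub>R coord_tvec A c p u d + s *\<^sub>R coord_tvec A c p v d"
    using linear_chart_deriv[OF differentiable_map_id assms, of d]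
    by (simp add: coord_tvec_eq linear_add linear_scale)
qed

text \<open>\<open>differential\<close> is computed in an arbitrarily selected chart
  \<open>c'\<close>. Factoring the same derivative once through \<open>c'\<close> and once through
  \<open>d\<close> shows that the choice does not matter.\<close>

lemma differential_coord_tvec:
  assumes \<phi>: "differentiable_map T A T A \<phi>" and c: "c \<in> charts_at A p" and d: "d \<in> charts_at A (\<phi> p)"
  shows "differential A A \<phi> p (coord_tvec A c p u) = coord_tvec A d (\<phi> p) (chart_deriv c d \<phi> p u)"
proof -
  define c' where "c' = (SOME c. c \<in> charts_at A p)"
  have c': "c' \<in> charts_at A p" unfolding c'_def using c by (rule someI)
  have "chart_deriv c' d' \<phi> p (chart_deriv c c' (\<lambda>q. q) p u) = chart_deriv d d' (\<lambda>q. q) (\<phi> p) (chart_deriv c d \<phi> p u)"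
    if "d' \<in> charts_at A (\<phi> p)" for d'
    using compose[OF differentiable_map_id \<phi> _ c c' that, of \<phi>]
      compose[OF \<phi> differentiable_map_id _ c d that, of \<phi>] by (simp add: fun_eq_iff)
  then show ?thesis
    unfolding differential_def Let_def c'_def[symmetric] coord_tvec_eq chart_deriv_def[symmetric]
    using c' by auto
qed

end

section \<open>Metrics and isometries in coordinates\<close>

locale riemannian_manifold = manifold T A for T :: "'p topology" and A :: "('p, 'e::real_normed_vector) chart set" +
  fixes g :: "('p, 'e) metric"
  assumes riemannian: "riemannian_metric T A g"
begin

abbreviation chart_metric :: "('p, 'e) chart \<Rightarrow> 'p \<Rightarrow> 'e \<Rightarrow> 'e \<Rightarrow> real" where
  "chart_metric c p \<equiv> metric_in_chart A g c (snd c p)"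

lemma chart_metric_eq:
  "c \<in> charts_at A p \<Longrightarrow> chart_metric c p u v = g p (coord_tvec A c p u) (coord_tvec A c p v)"
  by (simp add: metric_in_chart_def chart_inv_left[OF chart_on charts_at_mem(1)])

lemma inner_form_chart_metric:
  assumes c: "c \<in> charts_at A p"
  shows "inner_form (chart_metric c p)"
proof -
  note ct = coord_tvec_in_tangent_space[OF c]
  have R: "\<forall>p\<in>topspace T. \<forall>u\<in>tangent_space A p. \<forall>v\<in>tangent_space A p.
        g p u v = g p v u \<and>
        (\<forall>w\<in>tangent_space A p. \<forall>r s.
           g p (\<lambda>c. r *\<^sub>R u c + s *\<^sub>R v c) w = r * g p u w + s * g p v w) \<and>
        (u \<noteq> (\<lambda>c. 0) \<longrightarrow> 0 < g p u u)"
    using riemannian unfolding riemannian_metric_def by (rule conjunct1)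
  note R' = bspec[OF bspec[OF bspec[OF R topspaceI[OF c]] ct] ct]
  have sym: "chart_metric c p u v = chart_metric c p v u" for u v
    unfolding chart_metric_eq[OF c] by (rule conjunct1[OF R'])
  have lin: "chart_metric c p (r *\<^sub>R u + s *\<^sub>R v) w = r * chart_metric c p u w + s * chart_metric c p v w" for r s u v w
    unfolding chart_metric_eq[OF c] coord_tvec_linear[OF c]
    by (rule bspec[OF conjunct1[OF conjunct2[OF R']] ct, rule_format])
  have l: "linear (\<lambda>u. chart_metric c p u w)" for w
    using lin[of 1 _ 1 _ w] lin[of _ _ 0 0 w] by (intro linearI) auto
  moreover have "linear (chart_metric c p w)" for w
    using l[of w] unfolding sym[of _ w] .
  moreover have "0 < chart_metric c p u u" if "u \<noteq> 0" for u
  proof -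
    have "coord_tvec A c p u \<noteq> (\<lambda>c. 0)" using coord_tvec_component[OF c, of u] that by metis
    then show ?thesis
      unfolding chart_metric_eq[OF c] by (rule conjunct2[OF conjunct2[OF R'], rule_format])
  qed
  ultimately show ?thesis using sym by unfold_locales (auto simp: bilinear_def)
qed

lemma chart_metric_differentiable:
  assumes "c \<in> charts_at A p"
  shows "(\<lambda>x. metric_in_chart A g c x u v) differentiable (at (snd c p))"
proof (rule smooth_on_differentiable(1))
  show "smooth_on (snd c ` fst c) (\<lambda>x. metric_in_chart A g c x u v)"
    using riemannian charts_at_mem(2)[OF assms] unfolding riemannian_metric_def by simp
  show "snd c p \<in> snd c ` fst c" using charts_at_mem(1)[OF assms] by simp
qed

text \<open>Stated pointwise because right translation is later factored differently at each point,
  and for all charts so that composites can pass through any intermediate chart.\<close>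

definition isometric_at :: "('p \<Rightarrow> 'p) \<Rightarrow> 'p \<Rightarrow> bool" where
  "isometric_at \<phi> p \<longleftrightarrow> (\<forall>c\<in>charts_at A p. \<forall>d\<in>charts_at A (\<phi> p). \<forall>u v.
     chart_metric d (\<phi> p) (chart_deriv c d \<phi> p u) (chart_deriv c d \<phi> p v) = chart_metric c p u v)"

text \<open>Every tangent vector is a \<open>coord_tvec\<close>, and on these
  \<open>differential\<close> acts through \<open>chart_deriv\<close>, so both conditions compare
  the same numbers.\<close>

lemma isometric_map_iff:
  assumes \<phi>: "differentiable_map T A T A \<phi>"
  shows "isometric_map T A g \<phi> \<longleftrightarrow> (\<forall>p\<in>topspace T. isometric_at \<phi> p)"
proof -
  have key: "chart_metric d (\<phi> p) (chart_deriv c d \<phi> p u) (chart_deriv c d \<phi> p v)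
      = g (\<phi> p) (differential A A \<phi> p (coord_tvec A c p u)) (differential A A \<phi> p (coord_tvec A c p v))"
    if "c \<in> charts_at A p" "d \<in> charts_at A (\<phi> p)" for c d p u v
    using that by (simp add: chart_metric_eq differential_coord_tvec[OF \<phi>])
  show ?thesis
  proof
    assume iso: "isometric_map T A g \<phi>"
    show "\<forall>p\<in>topspace T. isometric_at \<phi> p"
      unfolding isometric_at_def
    proof (intro ballI allI)
      fix p c d u v assume "p \<in> topspace T" and cd: "c \<in> charts_at A p" "d \<in> charts_at A (\<phi> p)"
      then show "chart_metric d (\<phi> p) (chart_deriv c d \<phi> p u) (chart_deriv c d \<phi> p v) = chart_metric c p u v"
        unfolding key[OF cd] chart_metric_eq[OF cd(1)]
        using iso coord_tvec_in_tangent_space[OF cd(1)] unfolding isometric_map_def by blast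
    qed
  next
    assume iso: "\<forall>p\<in>topspace T. isometric_at \<phi> p"
    show "isometric_map T A g \<phi>" unfolding isometric_map_def
    proof (intro ballI)
      fix p u v assume p: "p \<in> topspace T" and uv: "u \<in> tangent_space A p" "v \<in> tangent_space A p"
      obtain c d where cd: "c \<in> charts_at A p" "d \<in> charts_at A (\<phi> p)"
        using charts_at_ex[OF p] charts_at_ex[OF differentiable_map_topspace[OF \<phi> p]] by blast
      have "g (\<phi> p) (differential A A \<phi> p (coord_tvec A c p (u c))) (differential A A \<phi> p (coord_tvec A c p (v c)))
          = g p (coord_tvec A c p (u c)) (coord_tvec A c p (v c))"
        unfolding key[OF cd, symmetric] chart_metric_eq[OF cd(1), symmetric]
        using iso p cd unfolding isometric_at_def by simp
      then show "g (\<phi> p) (differential A A \<phi> p u) (differential A A \<phi> p v) = g p u v"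
        unfolding tangent_vector_eq[OF uv(1) cd(1), symmetric] tangent_vector_eq[OF uv(2) cd(1), symmetric] .
    qed
  qed
qed

lemma isometric_at_compose:
  assumes \<phi>: "differentiable_map T A T A \<phi>" and \<psi>: "differentiable_map T A T A \<psi>"
    and eq: "\<And>q. q \<in> topspace T \<Longrightarrow> \<rho> q = \<psi> (\<phi> q)" and p: "p \<in> topspace T"
    and iso: "isometric_at \<phi> p" "isometric_at \<psi> (\<phi> p)"
  shows "isometric_at \<rho> p"
  unfolding isometric_at_def
proof (intro ballI allI)
  fix c e u v assume c: "c \<in> charts_at A p" and e: "e \<in> charts_at A (\<rho> p)"
  obtain d where d: "d \<in> charts_at A (\<phi> p)"
    using charts_at_ex[OF differentiable_map_topspace[OF \<phi> p]] by blast
  have e': "e \<in> charts_at A (\<psi> (\<phi> p))" using e eq p by simp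
  have "chart_deriv c e \<rho> p = chart_deriv d e \<psi> (\<phi> p) \<circ> chart_deriv c d \<phi> p"
    by (rule compose[OF \<phi> \<psi> eq c d e'])
  then show "chart_metric e (\<rho> p) (chart_deriv c e \<rho> p u) (chart_deriv c e \<rho> p v) = chart_metric c p u v"
    using iso c d e' eq[OF p] unfolding isometric_at_def by simp
qed

end

section \<open>The adjoint representation in a chart at the identity\<close>

locale lie_chart = riemannian_manifold T A g + finite_dim_normed Bs
  for T :: "'p topology" and A :: "('p, 'e::real_normed_vector) chart set" and g :: "('p, 'e) metric"
    and Bs :: "'e set" +
  fixes G :: "('p, 'm) monoid_scheme" (structure) and c :: "('p, 'e) chart"
  assumes lie: "lie_group G T A" and c: "c \<in> charts_at A \<one>"
    and left_invariant: "left_invariant_metric G T A g"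
begin

sublocale group G using lie by (simp add: lie_group_def)

lemma carrier: "topspace T = carrier G" using lie by (simp add: lie_group_def)

abbreviation mult :: "'p \<times> 'p \<Rightarrow> 'p" where "mult \<equiv> \<lambda>(x, y). x \<otimes> y"
abbreviation "L \<equiv> \<lambda>a x. a \<otimes> x"
abbreviation "R \<equiv> \<lambda>a x. x \<otimes> a"
abbreviation "conj_by \<equiv> inner_automorphism G"

lemma smooth_mult: "smooth_map (prod_topology T T) (prod_atlas A A) T A mult"
  using lie by (simp add: lie_group_def)

lemmas differentiable_mult = smooth_map_differentiable_map[OF smooth_mult]

lemma differentiable_inverse: "differentiable_map T A T A (\<lambda>x. inv x)"
  using lie by (intro smooth_map_differentiable_map) (simp add: lie_group_def)

lemma differentiable_L: "a \<in> carrier G \<Longrightarrow> differentiable_map T A T A (L a)"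
  using differentiable_map_compose[OF atlas atlas_on_prod[OF atlas atlas]
      differentiable_map_pair[OF atlas differentiable_map_const[OF atlas] differentiable_map_id] differentiable_mult, of a]
  by (simp add: carrier)

lemma differentiable_R: "a \<in> carrier G \<Longrightarrow> differentiable_map T A T A (R a)"
  using differentiable_map_compose[OF atlas atlas_on_prod[OF atlas atlas]
      differentiable_map_pair[OF atlas differentiable_map_id differentiable_map_const[OF atlas]] differentiable_mult, of a]
  by (simp add: carrier)

lemma differentiable_conj_by: "a \<in> carrier G \<Longrightarrow> differentiable_map T A T A (conj_by a)"
  using differentiable_map_compose[OF atlas atlas differentiable_L differentiable_R, of a "inv a"]
  by (simp add: inner_automorphism_def)

lemma conj_by_one: "a \<in> carrier G \<Longrightarrow> conj_by a \<one> = \<one>"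
  by (simp add: inner_automorphism_def)

lemma inv_mult_cancel:
  assumes "a \<in> carrier G" "z \<in> carrier G"
  shows "inv a \<otimes> (a \<otimes> z) = z" "a \<otimes> (inv a \<otimes> z) = z"
  using assms by (simp_all flip: m_assoc)

lemma conj_by_mult:
  assumes "a \<in> carrier G" "x \<in> carrier G" "y \<in> carrier G"
  shows "conj_by a (x \<otimes> y) = conj_by a x \<otimes> conj_by a y"
  using assms by (simp add: inner_automorphism_def m_assoc inv_mult_cancel)

lemma conj_by_comp:
  assumes "a \<in> carrier G" "d \<in> carrier G" "x \<in> carrier G"
  shows "conj_by (a \<otimes> d) x = conj_by a (conj_by d x)"
  using assms by (simp add: inner_automorphism_def m_assoc inv_mult_group)

lemma cc: "chart_on T c" by (rule chart_on[OF c])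

lemma c_carrier: "p \<in> fst c \<Longrightarrow> p \<in> carrier G"
  using chart_subset[OF cc] carrier by blast

lemma c_at: "p \<in> fst c \<Longrightarrow> c \<in> charts_at A p"
  using c by (simp add: charts_at_def)

lemma one_c: "\<one> \<in> fst c" by (rule charts_at_mem(1)[OF c])

definition x0 :: 'e where "x0 = snd c \<one>"

definition c2 :: "('p \<times> 'p, 'e \<times> 'e) chart" where
  "c2 = (fst c \<times> fst c, map_prod (snd c) (snd c))"

definition m :: "'e \<times> 'e \<Rightarrow> 'e" where "m = local_rep c2 c mult"

definition W :: "('e \<times> 'e) set" where "W = snd c2 ` (fst c2 \<inter> mult -` fst c)"

lemma c2: "chart_on (prod_topology T T) c2"
  unfolding c2_def by (rule chart_on_prod[OF cc cc])

lemma m_apply: "\<lbrakk>p \<in> fst c; q \<in> fst c\<rbrakk> \<Longrightarrow> m (snd c p, snd c q) = snd c (p \<otimes> q)"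
  using local_rep_apply[OF c2, of "(p, q)" c mult] by (simp add: m_def c2_def)

lemma W_I: "\<lbrakk>p \<in> fst c; q \<in> fst c; p \<otimes> q \<in> fst c\<rbrakk> \<Longrightarrow> (snd c p, snd c q) \<in> W"
  unfolding W_def by (rule image_eqI[of _ _ "(p, q)"]) (simp_all add: c2_def)

lemma smooth_m: "smooth_on W m"
proof -
  have "c2 \<in> prod_atlas A A" using charts_at_mem(2)[OF c] unfolding prod_atlas_def c2_def by blast
  then show ?thesis
    using smooth_mult charts_at_mem(2)[OF c] unfolding smooth_map_def W_def m_def by blast
qed

sublocale local_group Bs m W x0
proof
  show "open W" unfolding W_def
    by (rule open_chart_image[OF c2 cc differentiable_map_continuous[OF differentiable_mult]])
  show x0W: "(x0, x0) \<in> W" unfolding x0_def by (rule W_I) (simp_all add: one_c)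
  show "m differentiable (at z)" if "z \<in> W" for z
    by (rule smooth_on_differentiable(1)[OF smooth_m that])
  show "(\<lambda>z. frechet_derivative m (at z) V) differentiable (at (x0, x0))" for V
    by (rule smooth_on_differentiable(2)[OF smooth_m x0W])
  show "eventually (\<lambda>x. m (x, x0) = x) (nhds x0)"
    unfolding x0_def
    by (rule eventually_chart[OF cc openin_topspace]) (simp_all add: m_apply one_c carrier)
  show "eventually (\<lambda>x. m (x0, x) = x) (nhds x0)"
    unfolding x0_def
    by (rule eventually_chart[OF cc openin_topspace]) (simp_all add: m_apply one_c carrier)
qed

section \<open>Translations and the adjoint representation in the chart\<close>

lemma chart_deriv_L:
  assumes "p \<in> fst c" "q \<in> fst c" "p \<otimes> q \<in> fst c"
  shows "chart_deriv c c (L p) q = (\<lambda>u. Dm (snd c p, snd c q) (0, u))"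
proof (rule chart_deriv_eqI, rule has_derivative_eventually_cong)
  show "((\<lambda>y. m (snd c p, y)) has_derivative (\<lambda>u. Dm (snd c p, snd c q) (0, u))) (at (snd c q))"
    by (rule Dm_along) (use W_I[OF assms] in \<open>auto intro!: derivative_eq_intros\<close>)
  show "eventually (\<lambda>y. m (snd c p, y) = local_rep c c (L p) y) (nhds (snd c q))"
    by (rule eventually_chart[OF cc openin_topspace])
       (use assms c_carrier in \<open>simp_all add: m_apply local_rep_apply[OF cc] carrier\<close>)
qed

lemma chart_deriv_R:
  assumes "p \<in> fst c" "q \<in> fst c" "p \<otimes> q \<in> fst c"
  shows "chart_deriv c c (R q) p = (\<lambda>u. Dm (snd c p, snd c q) (u, 0))"
proof (rule chart_deriv_eqI, rule has_derivative_eventually_cong)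
  show "((\<lambda>y. m (y, snd c q)) has_derivative (\<lambda>u. Dm (snd c p, snd c q) (u, 0))) (at (snd c p))"
    by (rule Dm_along) (use W_I[OF assms] in \<open>auto intro!: derivative_eq_intros\<close>)
  show "eventually (\<lambda>y. m (y, snd c q) = local_rep c c (R q) y) (nhds (snd c p))"
    by (rule eventually_chart[OF cc openin_topspace])
       (use assms c_carrier in \<open>simp_all add: m_apply local_rep_apply[OF cc] carrier\<close>)
qed

definition Ad :: "'p \<Rightarrow> 'e \<Rightarrow> 'e" where
  "Ad a = chart_deriv c c (conj_by a) \<one>"

lemma linear_Ad: "a \<in> carrier G \<Longrightarrow> linear (Ad a)"
  unfolding Ad_def using linear_chart_deriv[OF differentiable_conj_by c] c conj_by_one by simp

lemma Ad_mult:
  assumes "a \<in> carrier G" "a' \<in> carrier G"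
  shows "Ad (a \<otimes> a') v = Ad a (Ad a' v)"
proof -
  have "chart_deriv c c (conj_by (a \<otimes> a')) \<one>
      = chart_deriv c c (conj_by a) (conj_by a' \<one>) \<circ> chart_deriv c c (conj_by a') \<one>"
    by (rule compose[OF differentiable_conj_by[OF assms(2)] differentiable_conj_by[OF assms(1)]])
       (use assms c in \<open>simp_all add: conj_by_one conj_by_comp carrier\<close>)
  then show ?thesis using assms by (simp add: Ad_def conj_by_one)
qed

text \<open>Conjugation is right translation by \<open>inv a\<close> followed by left translation by
  \<open>a\<close>. The identity is moved to \<open>inv a\<close> and back, so with both points in
  the domain of \<open>c\<close> a single chart suffices.\<close>

lemma Ad_eq_Dm:
  assumes a: "a \<in> fst c" "inv a \<in> fst c"
  shows "Ad a v = Dm (snd c a, snd c (inv a)) (0, Dm (x0, snd c (inv a)) (v, 0))"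
proof -
  note aG = c_carrier[OF a(1)]
  have "chart_deriv c c (conj_by a) \<one> = chart_deriv c c (L a) (\<one> \<otimes> inv a) \<circ> chart_deriv c c (R (inv a)) \<one>"
    by (rule compose[OF differentiable_R differentiable_L])
       (use aG a c c_at one_c in \<open>simp_all add: inner_automorphism_def m_assoc carrier\<close>)
  then show ?thesis
    using aG a one_c by (simp add: Ad_def chart_deriv_L chart_deriv_R x0_def)
qed

lemma Ad_derivative: "((\<lambda>x. Ad (chart_inv c x) v) has_derivative (\<lambda>X. bracket X v)) (at x0)"
proof -
  define \<iota> where "\<iota> = local_rep c c (\<lambda>x. inv x)"
  have \<iota>_apply: "\<iota> (snd c p) = snd c (inv p)" if "p \<in> fst c" for p
    unfolding \<iota>_def by (rule local_rep_apply[OF cc that])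
  have \<iota>: "(\<iota> has_derivative chart_deriv c c (\<lambda>x. inv x) \<one>) (at x0)"
    unfolding \<iota>_def x0_def by (rule chart_deriv[OF differentiable_inverse c]) (simp add: c)
  \<comment> \<open>Inversion need not preserve the chart domain; this is the neighbourhood of the
    identity whose inverses stay in it.\<close>
  define U where "U = {p \<in> topspace T. inv p \<in> fst c}"
  have U: "openin T U" unfolding U_def
    by (rule openin_continuous_map_preimage[OF differentiable_map_continuous[OF differentiable_inverse]])
       (use cc in \<open>simp add: chart_on_def\<close>)
  have oneU: "\<one> \<in> U" by (simp add: U_def carrier one_c)
  have ev: "eventually P (nhds x0)" if "\<And>q. \<lbrakk>q \<in> fst c; inv q \<in> fst c\<rbrakk> \<Longrightarrow> P (snd c q)" for P
    unfolding x0_def by (rule eventually_chart[OF cc U oneU one_c]) (use that in \<open>auto simp: U_def\<close>)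
  have "((\<lambda>x. Dm (x, \<iota> x) (0, Dm (x0, \<iota> x) (v, 0))) has_derivative (\<lambda>X. bracket X v)) (at x0)"
  proof (rule derivative_Ad[OF \<iota>])
    show "\<iota> x0 = x0" by (simp add: x0_def \<iota>_apply one_c)
    show "eventually (\<lambda>x. m (x, \<iota> x) = x0) (nhds x0)"
      by (rule ev) (simp add: \<iota>_apply m_apply c_carrier x0_def)
  qed
  then show ?thesis
    by (rule has_derivative_eventually_cong, intro ev)
       (simp add: \<iota>_apply Ad_eq_Dm chart_inv_left[OF cc])
qed

lemma Ad_one: "Ad \<one> v = v"
  using Ad_eq_Dm[of \<one> v] one_c Dm_x0 by (simp add: x0_def[symmetric])

abbreviation \<gamma> :: "'e \<Rightarrow> 'e \<Rightarrow> real" where "\<gamma> \<equiv> metric_in_chart A g c x0"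

lemma inner_form_\<gamma>: "inner_form \<gamma>"
  unfolding x0_def by (rule inner_form_chart_metric[OF c])

text \<open>Left translation by \<open>q\<close> takes the identity to \<open>q\<close>, with
  differential \<open>Dm (snd c q, x0) (0, u)\<close> at the identity. This supplies the invariance
  hypothesis of \<open>adjoint_skew\<close>.\<close>

lemma Dm_isometric:
  assumes "q \<in> fst c"
  shows "metric_in_chart A g c (snd c q) (Dm (snd c q, x0) (0, u)) (Dm (snd c q, x0) (0, v)) = \<gamma> u v"
proof -
  note qG = c_carrier[OF assms]
  have "isometric_at (L q) \<one>"
    using left_invariant isometric_map_iff[OF differentiable_L[OF qG]] qG carrier
    unfolding left_invariant_metric_def by simp
  moreover have "c \<in> charts_at A (q \<otimes> \<one>)" using c_at[OF assms] qG by simp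
  ultimately have "chart_metric c (q \<otimes> \<one>) (chart_deriv c c (L q) \<one> u) (chart_deriv c c (L q) \<one> v)
      = chart_metric c \<one> u v"
    using c unfolding isometric_at_def by blast
  then show ?thesis
    using qG assms one_c by (simp add: chart_deriv_L x0_def)
qed

section \<open>Harmonic conjugations at the identity\<close>

context
  assumes harmonic: "\<And>a. a \<in> carrier G \<Longrightarrow> harmonic_map T A g T A g (inner_automorphism G a)"
begin

lemma second_derivative_conj_by:
  assumes a: "a \<in> carrier G"
  shows "frechet_derivative (\<lambda>y. frechet_derivative (local_rep c c (conj_by a)) (at y) v) (at x0) u
    = mult2 (Ad a u) (Ad a v) - Ad a (mult2 u v)"
  unfolding Ad_def chart_deriv_def x0_def[symmetric]
proof (rule second_derivative_hom)
  let ?f = "local_rep c c (conj_by a)"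
  define S where "S = snd c ` (fst c \<inter> conj_by a -` fst c)"
  \<comment> \<open>\<open>harmonic_map\<close> includes smoothness, which provides the second
    derivatives of conjugation.\<close>
  have "smooth_map T A T A (conj_by a)" using harmonic[OF a] by (simp add: harmonic_map_def)
  then have smooth: "smooth_on S ?f"
    using charts_at_mem(2)[OF c] unfolding smooth_map_def S_def by blast
  note cont = differentiable_map_continuous[OF differentiable_conj_by[OF a]]
  show "open S" unfolding S_def by (rule open_chart_image[OF cc cc cont])
  show x0S: "x0 \<in> S" unfolding S_def x0_def using one_c a conj_by_one by simp
  show "?f differentiable (at x)" if "x \<in> S" for x
    by (rule smooth_on_differentiable(1)[OF smooth that])
  show "(\<lambda>y. frechet_derivative ?f (at y) v) differentiable (at x0)" for v
    by (rule smooth_on_differentiable(2)[OF smooth x0S])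
  show "?f x0 = x0" unfolding x0_def by (simp add: local_rep_apply[OF cc one_c] conj_by_one[OF a])
  define U where "U = {p \<in> topspace T. conj_by a p \<in> fst c}"
  have U: "openin T U" unfolding U_def
    by (rule openin_continuous_map_preimage[OF cont]) (use cc in \<open>simp add: chart_on_def\<close>)
  \<comment> \<open>Intersected with the domain of \<open>c2\<close>, this is the set of pairs for
    which both points, their product and both conjugates lie in the domain of
    \<open>c\<close>.\<close>
  have "openin (prod_topology T T) ({z \<in> topspace (prod_topology T T). mult z \<in> fst c} \<inter> U \<times> U)"
    by (intro openin_Int openin_continuous_map_preimage[OF differentiable_map_continuous[OF differentiable_mult]])
       (use cc U in \<open>simp_all add: chart_on_def openin_prod_Times_iff\<close>)
  from eventually_chart[OF c2 this, of "(\<one>, \<one>)" "\<lambda>z. case z of (x, y) \<Rightarrow> ?f (m (x, y)) = m (?f x, ?f y)"]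
  show "eventually (\<lambda>(x, y). ?f (m (x, y)) = m (?f x, ?f y)) (nhds (x0, x0))"
    using a by (auto simp: c2_def x0_def U_def one_c conj_by_one carrier m_apply local_rep_apply[OF cc] conj_by_mult)
qed

text \<open>The very basis selected inside \<open>metric_trace\<close>, so that
  \<open>tension\<close> at the identity unfolds to a sum over \<open>E\<close>.\<close>

definition E :: "'e set" where "E = (SOME B. orthonormal_basis \<gamma> B)"

lemma E: "orthonormal_basis \<gamma> E"
proof -
  interpret inner_form \<gamma> by (rule inner_form_\<gamma>)
  show ?thesis unfolding E_def by (rule someI_ex[OF orthonormal_basis_exists[OF fin spans]])
qed

text \<open>Conjugation fixes the identity, so the Christoffel symbols of source and target are both
  taken at \<open>x0\<close>; the second derivative comes from
  \<open>second_derivative_conj_by\<close>.\<close>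

lemma tension_conj_by:
  assumes a: "a \<in> carrier G"
  shows "(\<Sum>e\<in>E. mult2 (Ad a e) (Ad a e) - Ad a (mult2 e e)
    + christoffel A g c x0 (Ad a e) (Ad a e) - Ad a (christoffel A g c x0 e e)) = 0"
proof -
  have "tension A g A g (conj_by a) c c (snd c \<one>) = 0"
    using harmonic[OF a] c a conj_by_one carrier unfolding harmonic_map_def by auto
  moreover have "local_rep c c (conj_by a) x0 = x0"
    unfolding x0_def by (simp add: local_rep_apply[OF cc one_c] conj_by_one[OF a])
  moreover have "frechet_derivative (local_rep c c (conj_by a)) (at x0) = Ad a"
    by (simp add: Ad_def chart_deriv_def x0_def)
  ultimately show ?thesis
    unfolding tension_def metric_trace_def second_fundamental_form_def Let_def x0_def[symmetric] E_def[symmetric]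
    by (simp add: second_derivative_conj_by[OF a])
qed

lemma bracket_skew_adjoint: "\<gamma> (bracket X u) v + \<gamma> u (bracket X v) = 0"
proof (rule adjoint_skew[where \<gamma> = "metric_in_chart A g c" and F = "\<lambda>x. Ad (chart_inv c x)" and E = E, OF _ _ _ E])
  have ev: "eventually P (nhds x0)" if "\<And>q. q \<in> fst c \<Longrightarrow> P (snd c q)" for P
    unfolding x0_def by (rule eventually_chart[OF cc openin_topspace]) (use that one_c carrier in auto)
  show "eventually (\<lambda>x. inner_form (metric_in_chart A g c x)) (nhds x0)"
    by (rule ev) (rule inner_form_chart_metric[OF c_at])
  show "(\<lambda>x. metric_in_chart A g c x u v) differentiable (at x0)" for u v
    unfolding x0_def by (rule chart_metric_differentiable[OF c])
  show "eventually (\<lambda>x. metric_in_chart A g c x (Dm (x, x0) (0, u)) (Dm (x, x0) (0, v)) = \<gamma> u v) (nhds x0)" for u v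
    by (rule ev) (rule Dm_isometric)
  show "Ad (chart_inv c x0) v = v" for v
    by (simp add: x0_def chart_inv_left[OF cc one_c] Ad_one)
  show "eventually (\<lambda>a. linear (Ad (chart_inv c a))) (nhds x0)"
    by (rule ev) (simp add: chart_inv_left[OF cc] linear_Ad c_carrier)
  show "((\<lambda>x. Ad (chart_inv c x) v) has_derivative (\<lambda>X. bracket X v)) (at x0)" for v
    by (rule Ad_derivative)
  \<comment> \<open>The definite description is \<open>christoffel\<close> written out, since
    \<open>adjoint_skew\<close> is formulated without charts.\<close>
  show "eventually (\<lambda>a. (\<Sum>e\<in>E. mult2 (Ad (chart_inv c a) e) (Ad (chart_inv c a) e) - Ad (chart_inv c a) (mult2 e e)
     + (THE \<Gamma>. bilinear \<Gamma> \<and> (\<forall>u v. \<Gamma> u v = \<Gamma> v u) \<and>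
          (\<forall>w u v. frechet_derivative (\<lambda>x. metric_in_chart A g c x u v) (at x0) w = \<gamma> (\<Gamma> w u) v + \<gamma> u (\<Gamma> w v)))
         (Ad (chart_inv c a) e) (Ad (chart_inv c a) e)
     - Ad (chart_inv c a) ((THE \<Gamma>. bilinear \<Gamma> \<and> (\<forall>u v. \<Gamma> u v = \<Gamma> v u) \<and>
          (\<forall>w u v. frechet_derivative (\<lambda>x. metric_in_chart A g c x u v) (at x0) w = \<gamma> (\<Gamma> w u) v + \<gamma> u (\<Gamma> w v))) e e)) = 0) (nhds x0)"
    unfolding christoffel_def[symmetric]
    by (rule ev) (simp add: chart_inv_left[OF cc] tension_conj_by c_carrier)
qed

section \<open>From the Lie algebra to the connected group\<close>

text \<open>
  Near \<open>p\<close> one has \<open>Ad q = Ad (q p\<inverse>) (Ad p)\<close>, so the derivative at the identity is enough to see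
  that the pulled back inner product has zero derivative everywhere.
\<close>

lemma Ad_form_derivative_0:
  assumes d: "d \<in> charts_at A p"
  shows "((\<lambda>x. \<gamma> (Ad (chart_inv d x) u) (Ad (chart_inv d x) v)) has_derivative (\<lambda>h. 0)) (at (snd d p))"
proof -
  note dd = chart_on[OF d] and pG = topspaceI[OF d, unfolded carrier] and pd = charts_at_mem(1)[OF d]
  interpret inner_form \<gamma> by (rule inner_form_\<gamma>)
  define \<psi> where "\<psi> = local_rep d c (R (inv p))"
  define \<psi>' where "\<psi>' = chart_deriv d c (R (inv p)) p"
  have R: "differentiable_map T A T A (R (inv p))" using pG by (simp add: differentiable_R)
  have \<psi>p: "\<psi> (snd d p) = x0"
    unfolding \<psi>_def x0_def by (simp add: local_rep_apply[OF dd pd] pG)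
  have "(\<psi> has_derivative \<psi>') (at (snd d p))"
    unfolding \<psi>_def \<psi>'_def by (rule chart_deriv[OF R d]) (use c pG in simp)
  from has_derivative_compose[OF this, of "\<lambda>x. Ad (chart_inv c x) w" "\<lambda>X. bracket X w" for w]
  have D: "((\<lambda>x. Ad (chart_inv c (\<psi> x)) w) has_derivative (\<lambda>h. bracket (\<psi>' h) w)) (at (snd d p))" for w
    using Ad_derivative \<psi>p by simp
  have one: "Ad (chart_inv c (\<psi> (snd d p))) w = w" for w
    by (simp add: \<psi>p x0_def chart_inv_left[OF cc one_c] Ad_one)
  \<comment> \<open>At \<open>snd d p\<close> the outer \<open>Ad\<close> factors are the identity,
    so the product rule yields the skewness expression of the bracket at \<open>Ad p u\<close> and
    \<open>Ad p v\<close>.\<close>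
  have "((\<lambda>x. \<gamma> (Ad (chart_inv c (\<psi> x)) (Ad p u)) (Ad (chart_inv c (\<psi> x)) (Ad p v))) has_derivative (\<lambda>h. 0)) (at (snd d p))"
    using has_derivative_bilinear[OF bil D D, of "Ad p u" "Ad p v"]
    unfolding one bracket_skew_adjoint .
  then show ?thesis
  proof (rule has_derivative_eventually_cong)
    show "eventually (\<lambda>x. \<gamma> (Ad (chart_inv c (\<psi> x)) (Ad p u)) (Ad (chart_inv c (\<psi> x)) (Ad p v))
        = \<gamma> (Ad (chart_inv d x) u) (Ad (chart_inv d x) v)) (nhds (snd d p))"
    proof (rule eventually_chart[OF dd])
      show "openin T {q \<in> topspace T. q \<otimes> inv p \<in> fst c}"
        by (rule openin_continuous_map_preimage[OF differentiable_map_continuous[OF R]])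
           (use cc in \<open>simp add: chart_on_def\<close>)
      show "p \<in> {q \<in> topspace T. q \<otimes> inv p \<in> fst c}" "p \<in> fst d" using pG pd one_c carrier by simp_all
      fix q assume q: "q \<in> {q \<in> topspace T. q \<otimes> inv p \<in> fst c}" "q \<in> fst d"
      then have qG: "q \<in> carrier G" by (simp add: carrier)
      have "chart_inv c (\<psi> (snd d q)) = q \<otimes> inv p"
        using q unfolding \<psi>_def by (simp add: local_rep_apply[OF dd] chart_inv_left[OF cc])
      moreover have "Ad (q \<otimes> inv p) (Ad p w) = Ad q w" for w
        using Ad_mult[of "q \<otimes> inv p" p w] qG pG by (simp add: m_assoc)
      ultimately show "\<gamma> (Ad (chart_inv c (\<psi> (snd d q))) (Ad p u)) (Ad (chart_inv c (\<psi> (snd d q))) (Ad p v))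
        = \<gamma> (Ad (chart_inv d (snd d q)) u) (Ad (chart_inv d (snd d q)) v)"
        by (simp add: chart_inv_left[OF dd q(2)])
    qed
  qed
qed

text \<open>A coordinate ball is convex, so the vanishing derivative makes the form constant on it,
  and its preimage in the manifold is open.\<close>

lemma Ad_form_locally_constant:
  assumes p: "p \<in> topspace T"
  shows "\<exists>V. openin T V \<and> p \<in> V \<and> (\<forall>q\<in>V. \<gamma> (Ad q u) (Ad q v) = \<gamma> (Ad p u) (Ad p v))"
proof -
  obtain d where d: "d \<in> charts_at A p" using charts_at_ex[OF p] by blast
  note dd = chart_on[OF d] and pd = charts_at_mem(1)[OF d]
  have "open (snd d ` fst d)" using dd unfolding chart_on_def by blast
  then obtain r where r: "r > 0" "ball (snd d p) r \<subseteq> snd d ` fst d"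
    using pd openE by blast
  let ?k = "\<lambda>x. \<gamma> (Ad (chart_inv d x) u) (Ad (chart_inv d x) v)"
  have "(?k has_derivative (\<lambda>h. 0)) (at x within ball (snd d p) r)" if x: "x \<in> ball (snd d p) r" for x
  proof -
    obtain q where q: "q \<in> fst d" "x = snd d q" using x r(2) by blast
    have "d \<in> charts_at A q" using q(1) d by (simp add: charts_at_def)
    from Ad_form_derivative_0[OF this] show ?thesis unfolding q(2) by (rule has_derivative_at_withinI)
  qed
  then obtain k where k: "\<And>x. x \<in> ball (snd d p) r \<Longrightarrow> ?k x = k"
    using has_derivative_zero_constant[OF convex_ball, of "snd d p" r ?k] by blast
  define V where "V = {q \<in> fst d. snd d q \<in> ball (snd d p) r}"
  have "openin T V" unfolding V_def
    by (rule smooth_manifold_openin_chart_preimage[OF manifold charts_at_mem(2)[OF d] open_ball])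
  moreover have pV: "p \<in> V" using pd r(1) by (simp add: V_def)
  moreover have "\<gamma> (Ad q u) (Ad q v) = k" if "q \<in> V" for q
    using k[of "snd d q"] that chart_inv_left[OF dd, of q] unfolding V_def by simp
  ultimately show ?thesis by metis
qed

text \<open>A locally constant function on a connected space keeps its value at the identity, where
  \<open>Ad\<close> is trivial.\<close>

lemma Ad_isometric:
  assumes conn: "connected_space T" and a: "a \<in> carrier G"
  shows "\<gamma> (Ad a u) (Ad a v) = \<gamma> u v"
proof (rule ccontr)
  assume neq: "\<gamma> (Ad a u) (Ad a v) \<noteq> \<gamma> u v"
  let ?P = "\<lambda>q. \<gamma> (Ad q u) (Ad q v) = \<gamma> u v"
  \<comment> \<open>Any condition \<open>Q\<close> on a locally constant value cuts out an open set;
    equality and its negation would separate \<open>T\<close>.\<close>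
  have "openin T {q \<in> topspace T. Q (\<gamma> (Ad q u) (Ad q v))}" for Q
  proof (subst openin_subopen, intro ballI)
    fix p assume p: "p \<in> {q \<in> topspace T. Q (\<gamma> (Ad q u) (Ad q v))}"
    then obtain V where V: "openin T V" "p \<in> V" "\<forall>q\<in>V. \<gamma> (Ad q u) (Ad q v) = \<gamma> (Ad p u) (Ad p v)"
      using Ad_form_locally_constant[of p u v] by blast
    have "V \<subseteq> {q \<in> topspace T. Q (\<gamma> (Ad q u) (Ad q v))}"
    proof
      fix q assume "q \<in> V"
      then show "q \<in> {q \<in> topspace T. Q (\<gamma> (Ad q u) (Ad q v))}"
        using bspec[OF V(3)] p openin_subset[OF V(1)] by auto
    qed
    then show "\<exists>V. openin T V \<and> p \<in> V \<and> V \<subseteq> {q \<in> topspace T. Q (\<gamma> (Ad q u) (Ad q v))}"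
      using V by blast
  qed
  from this[of "\<lambda>r. r = \<gamma> u v"] this[of "\<lambda>r. r \<noteq> \<gamma> u v"]
  have "openin T {q \<in> topspace T. ?P q}" "openin T {q \<in> topspace T. \<not> ?P q}" by simp_all
  moreover have "topspace T \<subseteq> {q \<in> topspace T. ?P q} \<union> {q \<in> topspace T. \<not> ?P q}" by blast
  moreover have "{q \<in> topspace T. ?P q} \<inter> {q \<in> topspace T. \<not> ?P q} = {}" by blast
  moreover have "\<one> \<in> {q \<in> topspace T. ?P q}" by (simp add: Ad_one carrier)
  moreover have "a \<in> {q \<in> topspace T. \<not> ?P q}" using a neq by (simp add: carrier)
  ultimately show False
    using conn unfolding connected_space_def by blast
qed

text \<open>\<open>Ad_isometric\<close> speaks of the chart \<open>c\<close> alone. Other charts are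
  reached by re-expressing each tangent vector at the identity through its component in
  \<open>c\<close>.\<close>

lemma isometric_at_conj_by:
  assumes conn: "connected_space T" and a: "a \<in> carrier G"
  shows "isometric_at (conj_by a) \<one>"
proof -
  note diff = differentiable_conj_by[OF a] and one = conj_by_one[OF a]
  have key: "metric_in_chart A g c x0 (chart_deriv c c (conj_by a) \<one> u) (chart_deriv c c (conj_by a) \<one> v)
    = metric_in_chart A g c x0 u v" for u v
    using Ad_isometric[OF conn a] unfolding Ad_def .
  have oneT: "\<one> \<in> topspace T" by (simp add: carrier)
  show ?thesis unfolding isometric_at_def
  proof (intro ballI allI)
    fix d e u v assume d: "d \<in> charts_at A \<one>" and e: "e \<in> charts_at A (conj_by a \<one>)"
    have dc: "coord_tvec A d \<one> w = coord_tvec A c \<one> (coord_tvec A d \<one> w c)" for w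
      by (rule tangent_vector_eq[OF coord_tvec_in_tangent_space[OF d] c])
    have c': "c \<in> charts_at A (conj_by a \<one>)" using c one by simp
    have "coord_tvec A e \<one> (chart_deriv d e (conj_by a) \<one> w)
        = coord_tvec A c \<one> (chart_deriv c c (conj_by a) \<one> (coord_tvec A d \<one> w c))" for w
      using differential_coord_tvec[OF diff d e, of w]
        differential_coord_tvec[OF diff c c', of "coord_tvec A d \<one> w c"]
      unfolding dc[symmetric] one by simp
    then have "chart_metric e (conj_by a \<one>) (chart_deriv d e (conj_by a) \<one> u) (chart_deriv d e (conj_by a) \<one> v)
        = chart_metric c \<one> (coord_tvec A d \<one> u c) (coord_tvec A d \<one> v c)"
      using key e unfolding one x0_def by (simp add: chart_metric_eq c)
    also have "\<dots> = chart_metric d \<one> u v"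
      unfolding chart_metric_eq[OF c] chart_metric_eq[OF d] dc[symmetric] by (rule refl)
    finally show "chart_metric e (conj_by a \<one>) (chart_deriv d e (conj_by a) \<one> u) (chart_deriv d e (conj_by a) \<one> v)
        = chart_metric d \<one> u v" .
  qed
qed

text \<open>
  \<open>x a = (p a) (a\<inverse> (p\<inverse> x) a)\<close>, where conjugation is applied to a neighbourhood of the identity
  when \<open>x\<close> is near \<open>p\<close>.
\<close>

lemma right_invariant:
  assumes conn: "connected_space T"
  shows "right_invariant_metric G T A g"
  unfolding right_invariant_metric_def
proof
  fix a assume a: "a \<in> carrier G"
  have L: "isometric_at (L q) p" if "q \<in> carrier G" "p \<in> carrier G" for q p
  proof -
    have "isometric_map T A g (L q)"
      using left_invariant that(1) unfolding left_invariant_metric_def by blast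
    then show ?thesis
      using that(2) unfolding isometric_map_iff[OF differentiable_L[OF that(1)]] carrier by blast
  qed
  show "isometric_map T A g (R a)"
    unfolding isometric_map_iff[OF differentiable_R[OF a]]
  proof
    fix p assume "p \<in> topspace T"
    then have p: "p \<in> carrier G" by (simp add: carrier)
    let ?h = "\<lambda>q. conj_by (inv a) (inv p \<otimes> q)"
    \<comment> \<open>The factor \<open>inv p\<close> first moves \<open>p\<close> to the identity,
      where \<open>isometric_at_conj_by\<close> applies.\<close>
    have 1: "isometric_at ?h p"
    proof (rule isometric_at_compose[OF differentiable_L differentiable_conj_by refl])
      show "isometric_at (conj_by (inv a)) (inv p \<otimes> p)"
        using isometric_at_conj_by[OF conn] a p by simp
    qed (use a p L carrier in auto)
    have d: "differentiable_map T A T A ?h"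
      by (rule differentiable_map_compose[OF atlas atlas differentiable_L differentiable_conj_by]) (use a p in auto)
    show "isometric_at (R a) p"
    proof (rule isometric_at_compose[OF d differentiable_L[of "p \<otimes> a"]])
      show "q \<otimes> a = p \<otimes> a \<otimes> ?h q" if "q \<in> topspace T" for q
      proof -
        have q: "q \<in> carrier G" using that by (simp add: carrier)
        show ?thesis
          using a p q unfolding inner_automorphism_def by (simp add: m_assoc inv_mult_cancel)
      qed
      show "isometric_at (L (p \<otimes> a)) (?h p)" by (rule L) (use a p in \<open>simp_all add: inner_automorphism_def\<close>)
    qed (use a p 1 carrier in auto)
  qed
qed

end
end

theorem theorem3p3:
  fixes G :: "('p, 'm) monoid_scheme"
    and T :: "'p topology"
    and A :: "('p, 'e::real_normed_vector) chart set"
    and g :: "('p, 'e) metric"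
  assumes "lie_group G T A"
    and "connected_space T"
    and "riemannian_metric T A g"
    and "left_invariant_metric G T A g"
    and "\<And>a. a \<in> carrier G \<Longrightarrow> harmonic_map T A g T A g (inner_automorphism G a)"
  shows "bi_invariant_metric G T A g"
proof -
  have M: "smooth_manifold T A" and grp: "group G" and T: "topspace T = carrier G"
    using assms(1) by (auto simp: lie_group_def)
  obtain S :: "'e set" where S: "finite S" "span S = UNIV"
    using M unfolding smooth_manifold_def by blast
  \<comment> \<open>The finite spanning set of the model space is thinned to a basis.\<close>
  obtain Bs where Bs: "Bs \<subseteq> S" "independent Bs" "S \<subseteq> span Bs"
    using maximal_independent_subset by blast
  have "span Bs = UNIV" using S(2) span_mono[OF Bs(3)] by (simp add: span_span top_unique)
  moreover have "finite Bs" using Bs(1) S(1) finite_subset by blast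
  moreover obtain c where "c \<in> charts_at A (one G)"
    using atlas_charts_at[OF smooth_manifold_atlas_on[OF M]] T group.is_monoid[OF grp] monoid.one_closed by metis
  ultimately interpret lie_chart T A g Bs G c
    using M assms Bs(2) by unfold_locales
  show ?thesis
    unfolding bi_invariant_metric_def using assms(4) right_invariant[OF assms(5,2)] by blast
qed

end
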